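(* Let $(X_i)_{i=1}^\infty$ be independent with $X_i\sim\mathrm{Exp}(i)$ and $M=\sup_{i\ge1}X_i$. Then for every integer $k\ge1$, $$ \begin{aligned} E(M^k)=k!(-6)^k\Bigg(&\binom{2k-1}{k}-\frac{2\pi}{3\sqrt3}\binom{2k-2}{k-1} +\sum_{j=1}^{\lfloor k/2\rfloor}\frac{(-1)^j\pi^{2j}B_{2j}}{(2j)!}\big(2^{2j-1}-1\big)\Big(1-\frac{3}{3^{2j}}\Big)\binom{2k-2j-1}{k-1}\\ &-\frac{2}{\sqrt3}\sum_{j=1}^{\lfloor (k-1)/2\rfloor}\Big(\frac\pi3\Big)^{2j+1}(-1)^j\binom{2k-2j-2}{k-1}\left(\frac{3j+1}{(2j+1)!}-3\sum_{\ell=1}^{j}\frac{6^{2\ell-1}B_{2\ell}}{(2j-2\ell+1)!\,(2\ell)!}\right)\Bigg). \end{aligned} $$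
   Context: $\mathrm{Exp}(\lambda)$ denotes the exponential distribution with rate $\lambda$ (density $\lambda e^{-\lambda x}$, $x\ge0$). The Bernoulli numbers $B_n$ are defined by $\frac{z}{e^z-1}=\sum_{n\ge0}\frac{B_n}{n!}z^n$ for $|z|<2\pi$. Empty sums are zero. *)

theory Defs
  imports "HOL-Probability.Probability" "HOL-Computational_Algebra.Formal_Power_Series"
begin

definition bernoulli :: "nat \<Rightarrow> real" where
  "bernoulli n = fact n * fps_nth (fps_X div (fps_exp (1::real) - 1)) n"

end

theory Submission
  imports Defs
begin

text \<open>
  With \<open>q = e\<^bsup>-x\<^esup>\<close> one has \<open>P (M \<le> x) = \<Prod>\<^sub>i (1 - q\<^sup>i)\<close>, which Euler's pentagonal number theorem turns into
  an alternating sum of exponentials in \<open>x\<close>.  Integrating \<open>k x\<^bsup>k-1\<^esup> P (M > x)\<close> termwise gives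
  \<open>k! \<Sum>\<^sub>n (-1)\<^bsup>n+1\<^esup> 2\<^sup>k / (n (3n - 1))\<^sup>k\<close>, summed over all integers \<open>n \<noteq> 0\<close>.  Since
  \<open>-3n (3n - 1) = 3n (1 - 3n)\<close>, partial fractions reduce this to the sums of
  \<open>(-1)\<^sup>n ((3n)\<^bsup>-i\<^esup> + (1 - 3n)\<^bsup>-i\<^esup>)\<close>.  Their generating function is elementary by the partial fraction
  expansion of \<open>\<pi> / sin (\<pi> z)\<close>, and comparing coefficients with the power series of
  \<open>z / sin z = 2 B(\<i>z) - B(2\<i>z)\<close>, where \<open>B(z) = z / (e\<^sup>z - 1)\<close>, produces the Bernoulli numbers.
\<close>

subsection \<open>Euler's pentagonal number theorem\<close>

text \<open>The obstacle in the evaluation is the function u / sin (pi/3 - u) with u = pi t / 3: it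
  is expanded away from the zero of its sine, so the series of z / sin z does not apply. The product
  sin (3u) = 4 sin u sin (pi/3 - u) sin (pi/3 + u) moves the denominator to sin (3u), with numerator
  sqrt 3 sin (2u) + 2 sin^2 u. The sin^2 part reduces to cosecants of u and 3u; it is even in t and
  gives the sum without sqrt 3. The rest, a multiple of u sin (2u) / sin (3u), is odd and gives the
  terms with sqrt 3. There sin (2u) = sin (3u - u) brings in 3u cot (3u) = B(6iu) + 3iu, hence the
  powers of 6 and the convolution of Bernoulli numbers with sine coefficients. The binomial
  coefficient without pi comes from the summand n = 0, which the lattice sums lack.\<close>

definition tri :: "nat \<Rightarrow> nat" where "tri s = s * (s + 1) div 2"

lemma tri_0 [simp]: "tri 0 = 0" by (simp add: tri_def)
lemma tri_Suc: "tri (Suc s) = tri s + Suc s"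
  by (simp add: tri_def)

lemma real_tri: "real (tri s) = real s * (real s + 1) / 2"
  by (induction s) (simp_all add: tri_Suc field_simps)

definition euler_partial :: "real \<Rightarrow> nat \<Rightarrow> real" where
  "euler_partial q n = (\<Prod>i=1..n. 1 - q ^ i)"

text \<open>
  Shanks' finite form of the theorem: this sum equals a partial sum of the pentagonal series, while
  all its terms except the one for \<open>s = 0\<close>, which is the partial Euler product, vanish in the limit.
\<close>
definition shanks_sum :: "real \<Rightarrow> nat \<Rightarrow> real" where
  "shanks_sum q n = (\<Sum>s\<le>n. (-1)^s * (\<Prod>i\<in>{s<..n}. 1 - q ^ i) * q ^ (s * n + tri s))"

text \<open>Telescoping. The factor \<open>1 - q ^ s\<close> completes the product in
  \<open>a s\<close> to the one of index \<open>s - 1\<close>, so \<open>a s * (1 - q ^ s)\<close>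
  is minus the previous \<open>b\<close>. Only \<open>b n\<close> and the new top summand survive;
  they are the two pentagonal powers.\<close>

lemma shanks_sum_Suc:
  "shanks_sum q (Suc n) = shanks_sum q n
     - (-1)^n * (q ^ (Suc n * Suc n + tri n) + q ^ (Suc n * Suc n + tri (Suc n)))"
proof -
  define R where "R = (\<lambda>s m. \<Prod>i\<in>{s<..m}. 1 - q ^ i)"
  have R_Suc: "R s (Suc n) = R s n * (1 - q ^ Suc n)" if "s \<le> n" for s
  proof -
    have "{s<..Suc n} = insert (Suc n) {s<..n}" using that by auto
    then show ?thesis by (simp add: R_def mult.commute)
  qed
  have R_left: "R s n = R (Suc s) n * (1 - q ^ Suc s)" if "s < n" for s
  proof -
    have "{s<..n} = insert (Suc s) {Suc s<..n}" using that by auto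
    then show ?thesis by (simp add: R_def mult.commute)
  qed
  have [simp]: "R m m = 1" for m by (simp add: R_def)
  define a where "a = (\<lambda>s. (-1)^s * R s n * q ^ (s * n + tri s))"
  define b where "b = (\<lambda>s. (-1)^s * R s n * q ^ (Suc s * n + Suc s + tri s))"
  have step: "(-1)^s * R s (Suc n) * q ^ (s * Suc n + tri s) = a s - a s * (1 - q ^ s) - b s" if "s \<le> n" for s
    using that by (simp add: R_Suc a_def b_def power_add algebra_simps)
  have shift: "a (Suc s) * (1 - q ^ Suc s) = - b s" if "s < n" for s
    unfolding a_def b_def R_left[OF that] by (simp add: tri_Suc power_add mult_ac)
  have "shanks_sum q (Suc n) = (\<Sum>s\<le>n. a s - a s * (1 - q ^ s) - b s)
      + (-1)^Suc n * q ^ (Suc n * Suc n + tri (Suc n))"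
    using step by (simp add: shanks_sum_def R_def)
  also have "(\<Sum>s\<le>n. a s - a s * (1 - q ^ s) - b s) =
      (\<Sum>s\<le>n. a s) - (\<Sum>s\<le>n. a s * (1 - q ^ s)) - (\<Sum>s\<le>n. b s)"
    by (simp add: sum_subtractf)
  also have "(\<Sum>s\<le>n. a s * (1 - q ^ s)) = (\<Sum>s<n. a (Suc s) * (1 - q ^ Suc s))"
    by (simp add: sum.atMost_shift)
  also have "\<dots> = - (\<Sum>s<n. b s)"
    using shift by (simp add: sum_negf)
  also have "(\<Sum>s\<le>n. b s) = (\<Sum>s<n. b s) + b n"
    by (simp add: lessThan_Suc_atMost[symmetric])
  finally show ?thesis
    by (simp add: shanks_sum_def a_def b_def R_def algebra_simps)
qed

text \<open>The pentagonal numbers \<open>m (3m - 1) / 2\<close> and \<open>m (3m + 1) / 2\<close> with shifted index \<open>m = n + 1\<close>.\<close>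
definition pent_minus :: "nat \<Rightarrow> nat" where "pent_minus n = Suc n * Suc n + tri n"
definition pent_plus :: "nat \<Rightarrow> nat" where "pent_plus n = Suc n * Suc n + tri (Suc n)"

lemma shanks_identity:
  "shanks_sum q n = 1 - (\<Sum>s<n. (-1)^s * (q ^ pent_minus s + q ^ pent_plus s))"
proof (induction n)
  case (Suc n)
  then show ?case
    unfolding shanks_sum_Suc pent_minus_def[symmetric] pent_plus_def[symmetric] by simp
qed (simp add: shanks_sum_def)

lemma shanks_sum_minus_euler_partial:
  assumes "0 \<le> q" "q < 1"
  shows "\<bar>shanks_sum q n - euler_partial q n\<bar> \<le> real n * q ^ n"
proof -
  have "{0<..n} = {1..n}" by auto
  then have "shanks_sum q n - euler_partial q n =
      (\<Sum>s<n. (-1)^Suc s * (\<Prod>i\<in>{Suc s<..n}. 1 - q ^ i) * q ^ (Suc s * n + tri (Suc s)))"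
    by (simp add: shanks_sum_def euler_partial_def sum.atMost_shift)
  also have "\<bar>\<dots>\<bar> \<le> (\<Sum>s<n. q ^ n)"
  proof (rule order_trans[OF sum_abs], rule sum_mono)
    fix s assume "s \<in> {..<n}"
    have "\<bar>\<Prod>i\<in>{Suc s<..n}. 1 - q ^ i\<bar> \<le> 1"
      unfolding abs_prod by (rule prod_le_1) (use assms in \<open>auto simp: power_le_one\<close>)
    moreover have "q ^ (Suc s * n + tri (Suc s)) \<le> q ^ n"
      by (rule power_decreasing) (use assms in auto)
    moreover have "0 \<le> q ^ (Suc s * n + tri (Suc s))" using assms by simp
    ultimately show "\<bar>(-1)^Suc s * (\<Prod>i\<in>{Suc s<..n}. 1 - q ^ i) * q ^ (Suc s * n + tri (Suc s))\<bar> \<le> q ^ n"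
      using mult_mono[of "\<bar>\<Prod>i\<in>{Suc s<..n}. 1 - q ^ i\<bar>" 1 "q ^ (Suc s * n + tri (Suc s))" "q ^ n"]
      by (simp add: abs_mult)
  qed
  finally show ?thesis by simp
qed

lemma pentagonal_exponent_le:
  "n \<le> pent_minus n" "n \<le> pent_plus n"
  by (simp_all add: pent_minus_def pent_plus_def)

text \<open>\<open>lim\<close> is a genuine limit here: the Shanks sums converge because the series
  does, and they differ from the partial products by at most \<open>n * q ^ n\<close>.\<close>

theorem pentagonal_number:
  assumes "0 \<le> q" "q < 1"
  shows "(\<lambda>n. (-1)^n * (q ^ pent_minus n + q ^ pent_plus n))
           sums (1 - lim (euler_partial q))" (is "?f sums _")
proof -
  have "summable ?f"
  proof (rule summable_comparison_test')
    show "summable (\<lambda>n. 2 * q ^ n)" using assms by (intro summable_mult summable_geometric) auto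
    fix n
    have "q ^ pent_minus n \<le> q ^ n" "q ^ pent_plus n \<le> q ^ n"
      using assms pentagonal_exponent_le[of n] by (auto intro!: power_decreasing)
    then show "norm (?f n) \<le> 2 * q ^ n" using assms by (simp add: abs_mult)
  qed
  then have S: "(\<lambda>n. shanks_sum q n) \<longlonglongrightarrow> 1 - suminf ?f"
    unfolding shanks_identity by (intro tendsto_intros summable_LIMSEQ)
  have "(\<lambda>n. real n * q ^ n) \<longlonglongrightarrow> 0"
    using assms by (intro powser_times_n_limit_0) auto
  then have "(\<lambda>n. shanks_sum q n - euler_partial q n) \<longlonglongrightarrow> 0"
    by (rule Lim_null_comparison[rotated]) (use shanks_sum_minus_euler_partial[OF assms] in auto)
  from tendsto_diff[OF S this] have L: "euler_partial q \<longlonglongrightarrow> 1 - suminf ?f" by simp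
  have "lim (euler_partial q) = 1 - suminf ?f" using L by (rule limI)
  then show "?f sums (1 - lim (euler_partial q))"
    using \<open>summable ?f\<close> by (simp add: summable_sums)
qed

subsection \<open>Partial fractions\<close>

text \<open>Both sides of \<open>rGamma z * rGamma (1 - z) = sin (pi * z) / pi\<close> are
  differentiated, and the result is divided by the sine.\<close>

lemma Digamma_reflection:
  fixes z :: complex
  assumes "z \<notin> \<int>"
  shows "Digamma (1 - z) - Digamma z = of_real pi * cot (of_real pi * z)"
proof -
  have nz: "z \<notin> \<int>\<^sub>\<le>\<^sub>0" "1 - z \<notin> \<int>\<^sub>\<le>\<^sub>0" 
    using assms Ints_diff[of 1 "1 - z"] by (auto dest: nonpos_Ints_Int)
  have "((\<lambda>z. rGamma z * rGamma (1 - z)) has_field_derivative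
      rGamma z * rGamma (1 - z) * (Digamma (1 - z) - Digamma z)) (at z)"
    using nz by (auto intro!: derivative_eq_intros simp: algebra_simps)
  moreover have "((\<lambda>z. sin (of_real pi * z) / of_real pi :: complex) has_field_derivative cos (of_real pi * z)) (at z)"
    by (auto intro!: derivative_eq_intros)
  ultimately have "sin (of_real pi * z) / of_real pi * (Digamma (1 - z) - Digamma z) = cos (of_real pi * z)"
    unfolding rGamma_reflection_complex by (rule DERIV_unique)
  moreover have "sin (of_real pi * z) \<noteq> 0"
    using assms by (auto simp: sin_eq_0)
  ultimately show ?thesis by (simp add: cot_def field_simps)
qed

text \<open>The difference of the \<open>Digamma\<close> series at \<open>1 - z\<close> and
  \<open>z\<close> contains 1 / (z + n) where 1 / (z + n + 1) is wanted; the telescoping series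
  \<open>T\<close> makes the shift and contributes \<open>- 1 / z\<close>.\<close>

lemma cot_partial_fractions:
  fixes z :: complex
  assumes "z \<notin> \<int>"
  shows "(\<lambda>n. 1 / (z - of_nat (Suc n)) + 1 / (z + of_nat (Suc n)))
           sums (of_real pi * cot (of_real pi * z) - 1 / z)"
proof -
  have nz: "z \<noteq> 0" "1 - z \<noteq> 0" using assms by auto
  have D: "(\<lambda>n. inverse (of_nat (Suc n)) - inverse (w + of_nat n)) sums (Digamma w + euler_mascheroni)"
    if "w \<noteq> 0" for w :: complex
    using summable_Digamma[OF that] by (simp add: Digamma_def summable_sums)
  have T: "(\<lambda>n. inverse (z + of_nat (Suc n)) - inverse (z + of_nat n)) sums
                       (0 - inverse (z + of_nat 0))"
    by (intro telescope_sums filterlim_compose[OF tendsto_inverse_0]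
              tendsto_add_filterlim_at_infinity[OF tendsto_const] tendsto_of_nat)
  have eq: "inverse (1 - z + of_nat n) = - (1 / (z - of_nat (Suc n)))" for n
  proof -
    have "1 - z + of_nat n = - (z - of_nat (Suc n))" by simp
    then show ?thesis by (metis inverse_eq_divide inverse_minus_eq)
  qed
  from sums_add[OF sums_diff[OF D[OF nz(2)] D[OF nz(1)]] T]
  show ?thesis
    using Digamma_reflection[OF assms] unfolding eq
    by (simp add: inverse_eq_divide add_ac)
qed

text \<open>From 1 / sin (2u) = cot u - cot (2u) with 2u = pi z. The cotangent series at
  \<open>z / 2\<close> is twice the even-indexed part of the one at \<open>z\<close>; subtracting
  the full series leaves alternating signs.\<close>

lemma sin_partial_fractions:
  fixes z :: complex
  assumes "z \<notin> \<int>"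
  shows "(\<lambda>n. (-1) ^ Suc n * (1 / (z - of_nat (Suc n)) + 1 / (z + of_nat (Suc n))))
           sums (of_real pi / sin (of_real pi * z) - 1 / z)"
proof -
  define a where "a = (\<lambda>w n. 1 / (w - of_nat n) + 1 / (w + of_nat n) :: complex)"
  have z2: "z / 2 \<notin> \<int>"
    using assms Ints_mult[of 2 "z/2"] by auto
  have "(\<lambda>n. a (z/2) (Suc n)) sums (of_real pi * cot (of_real pi * (z/2)) - 1 / (z/2))"
    unfolding a_def by (rule cot_partial_fractions[OF z2])
  moreover have "a (z/2) n = 2 * a z (2 * n)" for n
  proof -
    have "z / 2 - of_nat n = (z - of_nat (2*n)) / 2" "z / 2 + of_nat n = (z + of_nat (2*n)) / 2"
      by (simp_all add: field_simps)
    then show ?thesis unfolding a_def by (simp only: divide_divide_eq_right) (simp add: algebra_simps)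
  qed
  ultimately have "(\<lambda>n. 2 * a z (2 * Suc n)) sums (of_real pi * cot (of_real pi * (z/2)) - 2 / z)"
    by simp
  \<comment> \<open>Index \<open>n\<close> belongs to the poles at plus and minus
    \<open>n + 1\<close>, so the even poles sit at odd \<open>n\<close>.\<close>
  then have even: "(\<lambda>n. if odd n then 2 * a z (Suc n) else 0) sums (of_real pi * cot (of_real pi * (z/2)) - 2 / z)"
  proof (subst sums_mono_reindex[of "\<lambda>n. 2 * n + 1", symmetric])
    show "strict_mono (\<lambda>n::nat. 2 * n + 1)" by (auto simp: strict_mono_def)
    fix n assume "n \<notin> range (\<lambda>n::nat. 2 * n + 1)"
    then have "even n" by (metis oddE rangeI)
    then show "(if odd n then 2 * a z (Suc n) else 0) = 0" by simp
  qed simp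
  have "(\<lambda>n. a z (Suc n)) sums (of_real pi * cot (of_real pi * z) - 1 / z)"
    unfolding a_def by (rule cot_partial_fractions[OF assms])
  from sums_diff[OF even this]
  have "(\<lambda>n. (-1) ^ Suc n * a z (Suc n)) sums
     (of_real pi * cot (of_real pi * (z/2)) - 2 / z - (of_real pi * cot (of_real pi * z) - 1 / z))"
    by (rule sums_cong[THEN iffD1, rotated]) auto
  moreover have "of_real pi * cot (of_real pi * (z/2)) - 2 / z - (of_real pi * cot (of_real pi * z) - 1 / z)
     = of_real pi / sin (of_real pi * z) - 1 / z"
  proof -
    define u where "u = of_real pi * (z / 2)"
    have "sin u \<noteq> 0" using z2 by (auto simp: u_def sin_eq_0)
    have u2: "of_real pi * z = 2 * u" by (simp add: u_def)
    have "sin (2 * u) \<noteq> 0" using assms by (auto simp: sin_eq_0 simp flip: u2)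
    then have "cot u - cot (2 * u) = (sin (2 * u) * cos u - cos (2 * u) * sin u) / (sin u * sin (2 * u))"
      using \<open>sin u \<noteq> 0\<close> by (simp add: cot_def diff_frac_eq mult.commute)
    also have "\<dots> = 1 / sin (2 * u)"
      using \<open>sin u \<noteq> 0\<close> sin_diff[of "2 * u" u] by simp
    finally have "cot u - cot (2 * u) = 1 / sin (2 * u)" .
    then have "of_real pi * cot u - of_real pi * cot (2*u) = of_real pi / sin (2*u)"
      by (simp add: right_diff_distrib[symmetric])
    then show ?thesis unfolding u2 u_def[symmetric] by (simp add: algebra_simps)
  qed
  ultimately show ?thesis by (simp add: a_def)
qed

text \<open>The expansion of (x + y)^(2k-1) = 1 is cut in the middle, and each half is a truncated
  negative binomial sum. For x in [0,1] this says that in 2k - 1 coin tosses exactly one side shows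
  up at least k times, sorted by the toss at which it does so for the k-th time.\<close>

lemma partial_fraction_power_aux:
  fixes x y :: real
  assumes "x + y = 1" "k \<ge> 1"
  shows "(\<Sum>m<k. real ((k - 1 + m) choose (k - 1)) * (x ^ k * y ^ m + y ^ k * x ^ m)) = 1"
proof -
  obtain p where k: "k = Suc p" using assms(2) by (cases k) auto
  have half: "v ^ Suc p * (\<Sum>m\<le>p. real ((p + m) choose p) * u ^ m)
     = (\<Sum>j\<le>p. real ((2*p+1) choose j) * u ^ j * v ^ (2*p+1-j))" if "u + v = 1" for u v :: real
  proof -
    have "(\<Sum>m\<le>p. real ((p + m) choose p) * u ^ m) = (\<Sum>m\<le>p. (real m + real (Suc p) - 1 gchoose m) * u^m * (u + v)^(p-m))"
    proof (rule sum.cong)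
      fix m
      have "real m + real (Suc p) - 1 = real (p + m)" by simp
      moreover have "(p + m) choose p = (p + m) choose m" by (simp add: binomial_symmetric[of p])
      ultimately show "real ((p + m) choose p) * u ^ m = (real m + real (Suc p) - 1 gchoose m) * u^m * (u + v)^(p-m)"
        using that by (simp only: binomial_gbinomial of_nat_add) simp
    qed simp
    also have "\<dots> = (\<Sum>m\<le>p. (real p + real (Suc p) gchoose m) * u^m * v^(p-m))"
      by (rule gbinomial_partial_sum_poly_xpos[symmetric])
    also have "\<dots> = (\<Sum>m\<le>p. real ((2*p+1) choose m) * u^m * v^(p-m))"
    proof (rule sum.cong)
      fix m
      have "real p + real (Suc p) = real (2*p+1)" by simp
      then show "(real p + real (Suc p) gchoose m) * u^m * v^(p-m) = real ((2*p+1) choose m) * u^m * v^(p-m)"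
        by (simp only: binomial_gbinomial)
    qed simp
    also have "v ^ Suc p * \<dots> = (\<Sum>j\<le>p. real ((2*p+1) choose j) * u ^ j * v ^ (2*p+1-j))"
      unfolding sum_distrib_left
    proof (rule sum.cong)
      fix j assume "j \<in> {..p}"
      then have "2*p+1-j = Suc p + (p - j)" by auto
      then show "v ^ Suc p * (real ((2*p+1) choose j) * u ^ j * v ^ (p-j)) = real ((2*p+1) choose j) * u ^ j * v ^ (2*p+1-j)"
        by (simp only: power_add) (simp only: mult_ac)
    qed simp
    finally show ?thesis .
  qed
  have "{..2*p+1} = {..p} \<union> {p<..2*p+1}" by auto
  then have "(x + y) ^ (2*p+1) = (\<Sum>j\<le>p. real ((2*p+1) choose j) * x ^ j * y ^ (2*p+1-j))
      + (\<Sum>j\<in>{p<..2*p+1}. real ((2*p+1) choose j) * x ^ j * y ^ (2*p+1-j))"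
    unfolding binomial_ring by (simp only:) (subst sum.union_disjoint, auto)
  also have "(\<Sum>j\<in>{p<..2*p+1}. real ((2*p+1) choose j) * x ^ j * y ^ (2*p+1-j))
      = (\<Sum>j\<le>p. real ((2*p+1) choose j) * y ^ j * x ^ (2*p+1-j))"
    by (rule sum.reindex_bij_witness[of _ "\<lambda>j. 2*p+1-j" "\<lambda>j. 2*p+1-j"])
       (auto simp: binomial_symmetric[symmetric] mult_ac)
  also have "(\<Sum>j\<le>p. real ((2*p+1) choose j) * x ^ j * y ^ (2*p+1-j)) = y ^ Suc p * (\<Sum>m\<le>p. real ((p + m) choose p) * x ^ m)"
    using half[of x y] assms by simp
  also have "(\<Sum>j\<le>p. real ((2*p+1) choose j) * y ^ j * x ^ (2*p+1-j)) = x ^ Suc p * (\<Sum>m\<le>p. real ((p + m) choose p) * y ^ m)"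
    using half[of y x] assms by (simp add: add.commute)
  finally show ?thesis
    using assms by (simp add: k lessThan_Suc_atMost sum_distrib_left sum.distrib algebra_simps)
qed

lemma partial_fraction_power:
  fixes x :: real
  assumes "x \<noteq> 0" "x \<noteq> 1" "k \<ge> 1"
  shows "1 / (x * (1 - x)) ^ k =
     (\<Sum>i=1..k. real ((2*k - i - 1) choose (k - 1)) * (1 / x ^ i + 1 / (1 - x) ^ i))"
proof -
  define y where "y = 1 - x"
  have nz: "x \<noteq> 0" "y \<noteq> 0" using assms by (auto simp: y_def)
  have "1 / (x * y) ^ k = (\<Sum>m<k. real ((k - 1 + m) choose (k - 1)) * (x ^ k * y ^ m + y ^ k * x ^ m)) / (x * y) ^ k"
    using partial_fraction_power_aux[of x y k] assms by (simp add: y_def)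
  also have "\<dots> = (\<Sum>m<k. real ((k - 1 + m) choose (k - 1)) * (1 / x ^ (k - m) + 1 / y ^ (k - m)))"
    unfolding sum_divide_distrib
    by (rule sum.cong) (use nz in \<open>auto simp: power_diff power_mult_distrib field_simps\<close>)
  also have "\<dots> = (\<Sum>i=1..k. real ((2*k - i - 1) choose (k - 1)) * (1 / x ^ i + 1 / y ^ i))"
    by (rule sum.reindex_bij_witness[of _ "\<lambda>i. k - i" "\<lambda>i. k - i"]) (auto simp: mult_2)
  finally show ?thesis by (simp add: y_def)
qed

subsection \<open>Power series with Bernoulli coefficients\<close>

text \<open>The expansion of \<open>c z / (exp (c z) - 1)\<close> at \<open>z = 0\<close>.\<close>
definition bernoulli_fps :: "complex \<Rightarrow> complex fps" where
  "bernoulli_fps c = Abs_fps (\<lambda>n. c ^ n * of_real (bernoulli n / fact n))"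

text \<open>The divisor has constant term 0 and is not a unit; the quotient in
  \<open>bernoulli\<close> is exact because both series have subdegree 1.\<close>

lemma bernoulli_fps_1: "bernoulli_fps 1 * (fps_exp 1 - 1) = fps_X"
proof -
  let ?F = "fps_X div (fps_exp (1::real) - 1)"
  have "subdegree (fps_exp (1::real) - 1) = 1"
    by (rule subdegreeI) auto
  then have "fps_exp (1::real) - 1 dvd fps_X"
    by (subst fps_dvd_iff) auto
  then have F: "?F * (fps_exp 1 - 1) = fps_X" by (rule dvd_div_mult_self)
  have nth: "fps_nth (bernoulli_fps 1) n = of_real (fps_nth ?F n)" for n
    by (simp add: bernoulli_fps_def bernoulli_def)
  show ?thesis
  proof (rule fps_ext)
    fix n
    have "fps_nth (bernoulli_fps 1 * (fps_exp 1 - 1)) n = of_real (fps_nth (?F * (fps_exp 1 - 1)) n)"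
      by (simp add: fps_mult_nth nth) (rule sum.cong, auto)
    then show "fps_nth (bernoulli_fps 1 * (fps_exp 1 - 1)) n = fps_nth fps_X n"
      unfolding F by simp
  qed
qed

lemma bernoulli_fps_mult: "bernoulli_fps c * (fps_exp c - 1) = fps_const c * fps_X"
proof -
  let ?l = "fps_const c * fps_X :: complex fps"
  have "(bernoulli_fps 1 * (fps_exp 1 - 1)) oo ?l = (bernoulli_fps 1 oo ?l) * ((fps_exp 1 - 1) oo ?l)"
    by (rule fps_compose_mult_distrib) simp
  moreover have "bernoulli_fps 1 oo ?l = bernoulli_fps c"
    by (simp add: fps_compose_linear bernoulli_fps_def fps_eq_iff)
  moreover have "(fps_exp 1 - 1) oo ?l = fps_exp c - 1"
    by (simp add: fps_compose_sub_distrib)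
  ultimately show ?thesis by (simp add: bernoulli_fps_1)
qed

text \<open>B(-z) = B(z) + z, so all odd coefficients except the first equal their own
  negatives.\<close>

lemma bernoulli_odd_eq_0:
  assumes "odd n" "n > 1"
  shows "bernoulli n = 0"
proof -
  let ?e = "fps_exp 1 :: complex fps"
  have e: "fps_exp (-1) * ?e = 1" using fps_exp_add_mult[of "-1" "1::complex"] by simp
  have "bernoulli_fps (-1) * (fps_exp (-1) - 1) * ?e = fps_const (-1) * fps_X * ?e"
    by (simp only: bernoulli_fps_mult)
  moreover have "bernoulli_fps (-1) * (fps_exp (-1) - 1) * ?e = bernoulli_fps (-1) * (fps_exp (-1) * ?e - ?e)"
    by (simp add: algebra_simps)
  moreover have "fps_const (-1) = (-1 :: complex fps)"
    by (simp add: fps_const_neg[symmetric] del: fps_const_neg)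
  ultimately have "bernoulli_fps (-1) * (?e - 1) = fps_X * ?e"
    unfolding e by (simp add: right_diff_distrib) (metis add.commute diff_add_cancel diff_eq_eq minus_diff_eq)
  also have "\<dots> = (bernoulli_fps 1 + fps_X) * (?e - 1)"
    using bernoulli_fps_1 by (simp add: algebra_simps)
  finally have "bernoulli_fps (-1) = bernoulli_fps 1 + fps_X"
    by simp
  then have "fps_nth (bernoulli_fps (-1)) n = fps_nth (bernoulli_fps 1 + fps_X) n" by simp
  then have "- complex_of_real (bernoulli n / fact n) = of_real (bernoulli n / fact n)"
    using assms by (simp add: bernoulli_fps_def)
  then have "- (bernoulli n / fact n) = bernoulli n / fact n"
    by (metis of_real_eq_iff of_real_minus)
  then show ?thesis by simp
qed

text \<open>The expansion of \<open>c z / sin (c z)\<close> at \<open>z = 0\<close>.\<close>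
definition cosec_fps :: "complex \<Rightarrow> complex fps" where
  "cosec_fps c = 2 * bernoulli_fps (\<i> * c) - bernoulli_fps (\<i> * (2 * c))"

text \<open>Euler's formulas cleared of negative exponents: with E = exp (icz), the identities below
  become polynomial identities in E.\<close>

lemma fps_sin_mult_exp:
  "2 * fps_const \<i> * fps_sin c * fps_exp (\<i> * c) = fps_exp (\<i> * (2 * c)) - 1"
  "2 * fps_cos c * fps_exp (\<i> * c) = fps_exp (\<i> * (2 * c)) + 1"
proof -
  have e: "fps_exp (\<i> * (2 * c)) = fps_exp (\<i> * c) * fps_exp (\<i> * c)"
    by (simp add: fps_exp_add_mult[symmetric] algebra_simps)
  have m: "fps_exp (- (\<i> * c)) * fps_exp (\<i> * c) = 1"
    using fps_exp_add_mult[of "- (\<i> * c)" "\<i> * c"] by simp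
  have s: "2 * fps_const \<i> * fps_sin c = fps_exp (\<i> * c) - fps_exp (- (\<i> * c))"
    unfolding fps_exp_minus_ii_sin_cos fps_exp_ii_sin_cos by (simp add: algebra_simps)
  have co: "2 * fps_cos c = fps_exp (\<i> * c) + fps_exp (- (\<i> * c))"
    unfolding fps_exp_minus_ii_sin_cos fps_exp_ii_sin_cos by (simp add: algebra_simps)
  show "2 * fps_const \<i> * fps_sin c * fps_exp (\<i> * c) = fps_exp (\<i> * (2 * c)) - 1"
    unfolding s e left_diff_distrib m ..
  show "2 * fps_cos c * fps_exp (\<i> * c) = fps_exp (\<i> * (2 * c)) + 1"
    unfolding co e distrib_right m ..
qed

lemma fps_sin_eq_0_iff: "fps_sin c = 0 \<longleftrightarrow> c = (0 :: complex)"
proof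
  assume "fps_sin c = 0"
  then have "fps_nth (fps_sin c) 1 = 0" by simp
  then show "c = 0" by (simp add: fps_sin_def)
qed (auto simp: fps_sin_def fps_eq_iff elim!: oddE)

text \<open>With E = exp (icz) this is 2 / (E - 1) - 2 / (E^2 - 1) = 2E / (E^2 - 1), cleared of
  denominators.\<close>

lemma cosec_fps_mult_sin: "cosec_fps c * fps_sin c = fps_const c * fps_X"
proof -
  define E where "E = fps_exp (\<i> * c)"
  define I where "I = fps_const \<i>"
  have nz: "E \<noteq> 0" "I \<noteq> 0" by (simp_all add: E_def I_def)
  have EE: "fps_exp (\<i> * (2 * c)) = E * E"
    by (simp add: E_def fps_exp_add_mult[symmetric] algebra_simps)
  have B1: "bernoulli_fps (\<i> * c) * (E - 1) = I * fps_const c * fps_X"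
    by (simp add: E_def I_def bernoulli_fps_mult)
  have B2: "bernoulli_fps (\<i> * (2 * c)) * (E * E - 1) = 2 * (I * fps_const c * fps_X)"
    unfolding EE[symmetric] bernoulli_fps_mult by (simp add: I_def numeral_fps_const mult_ac)
  have S: "2 * I * fps_sin c * E = E * E - 1"
    using fps_sin_mult_exp(1)[of c] by (simp add: E_def[symmetric] I_def[symmetric] EE)
  have "2 * I * E * (cosec_fps c * fps_sin c) = cosec_fps c * (E * E - 1)"
    unfolding S[symmetric] by (simp add: mult_ac)
  also have "\<dots> = 2 * (bernoulli_fps (\<i> * c) * (E - 1)) * (E + 1) - bernoulli_fps (\<i> * (2 * c)) * (E * E - 1)"
    by (simp add: cosec_fps_def algebra_simps)
  also have "\<dots> = 2 * I * E * (fps_const c * fps_X)"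
    unfolding B1 B2 by (simp add: algebra_simps)
  finally show ?thesis using nz by simp
qed

text \<open>With u = cz, sin (2u) = sin (3u - u) gives sin (2u) / sin (3u) = cos u - cot (3u) sin u.
  The last bracket is the series of 3u cot (3u), since w cot w = B(2iw) + iw.\<close>

lemma cosec_fps_mult_sin_double:
  "cosec_fps (3 * c) * fps_sin (2 * c) =
     fps_const (3 * c) * fps_X * fps_cos c
     - fps_sin c * (bernoulli_fps (\<i> * (6 * c)) + fps_const (3 * \<i> * c) * fps_X)"
proof (cases "c = 0")
  case True
  then have "fps_sin c = 0" "fps_sin (2 * c) = 0" by (simp_all add: fps_sin_eq_0_iff)
  with True show ?thesis by simp
next
  case False
  define E where "E = fps_exp (\<i> * (3 * c))"
  define I where "I = fps_const \<i>"
  define Y where "Y = fps_const (3 * c) * fps_X"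
  let ?C = "bernoulli_fps (\<i> * (6 * c)) + I * Y"
  have nz: "E \<noteq> 0" "I \<noteq> 0" by (simp_all add: E_def I_def)
  have EE: "fps_exp (\<i> * (6 * c)) = E * E"
    by (simp add: E_def fps_exp_add_mult[symmetric] algebra_simps)
  have S: "2 * I * fps_sin (3 * c) * E = E * E - 1" and Co: "2 * fps_cos (3 * c) * E = E * E + 1"
    using fps_sin_mult_exp[of "3 * c"] by (simp_all add: E_def[symmetric] I_def[symmetric] EE)
  have B: "bernoulli_fps (\<i> * (6 * c)) * (E * E - 1) = 2 * (I * Y)"
    unfolding EE[symmetric] bernoulli_fps_mult by (simp add: I_def Y_def numeral_fps_const mult_ac)
  have "2 * I * E * (?C * fps_sin (3 * c)) = ?C * (E * E - 1)"
    unfolding S[symmetric] by (simp add: mult_ac)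
  also have "\<dots> = I * Y * (E * E + 1)"
    unfolding distrib_right B by (simp add: algebra_simps)
  also have "\<dots> = 2 * I * E * (Y * fps_cos (3 * c))"
    unfolding Co[symmetric] by (simp add: mult_ac)
  finally have C: "?C * fps_sin (3 * c) = Y * fps_cos (3 * c)" using nz by simp
  have "fps_sin (3 * c + - c) = fps_sin (3 * c) * fps_cos c - fps_cos (3 * c) * fps_sin c"
    unfolding fps_sin_add by (simp add: fps_sin_even fps_cos_odd)
  then have sin2: "fps_sin (2 * c) = fps_sin (3 * c) * fps_cos c - fps_cos (3 * c) * fps_sin c"
    by simp
  have "(cosec_fps (3 * c) * fps_sin (2 * c)) * fps_sin (3 * c) = (cosec_fps (3 * c) * fps_sin (3 * c)) * fps_sin (2 * c)"
    by (simp add: mult_ac)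
  also have "\<dots> = Y * fps_cos c * fps_sin (3 * c) - (Y * fps_cos (3 * c)) * fps_sin c"
    unfolding cosec_fps_mult_sin sin2 Y_def by (simp add: algebra_simps)
  also have "\<dots> = (Y * fps_cos c - fps_sin c * ?C) * fps_sin (3 * c)"
    unfolding C[symmetric] by (simp add: algebra_simps)
  finally have "cosec_fps (3 * c) * fps_sin (2 * c) = Y * fps_cos c - fps_sin c * ?C"
    using fps_sin_eq_0_iff[of "3 * c"] False by simp
  then show ?thesis by (simp add: Y_def I_def mult_ac)
qed

subsection \<open>The alternating lattice sums and their generating function\<close>

text \<open>Cutting row \<open>n\<close> after \<open>N\<close> terms costs at most
  \<open>g n * T N\<close>, where \<open>T N\<close> is the tail of \<open>h\<close>; summed over
  all rows this still tends to 0 with \<open>T N\<close>.\<close>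

lemma sums_swap_dominated:
  fixes f :: "nat \<Rightarrow> nat \<Rightarrow> 'a :: banach"
  assumes bound: "\<And>n i. norm (f n i) \<le> g n * h i" and g: "summable g" and h: "summable h"
    and g0: "\<And>n. 0 \<le> g n"
    and r: "\<And>n. f n sums r n" and c: "\<And>i. (\<lambda>n. f n i) sums c i" and S: "r sums S"
  shows "c sums S"
proof -
  define T where "T = (\<lambda>N. \<Sum>i. h (i + N))"
  have "T = (\<lambda>N. suminf h - (\<Sum>i<N. h i))"
    unfolding T_def using suminf_minus_initial_segment[OF h] by auto
  moreover have "(\<lambda>N. suminf h - (\<Sum>i<N. h i)) \<longlonglongrightarrow> suminf h - suminf h"
    by (intro tendsto_intros summable_LIMSEQ h)
  ultimately have T0: "T \<longlonglongrightarrow> 0" by simp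
  have le: "norm ((\<Sum>i<N. c i) - S) \<le> suminf g * T N" for N
  proof -
    have "(\<lambda>n. (\<Sum>i<N. f n i) - r n) sums ((\<Sum>i<N. c i) - S)"
      by (intro sums_diff sums_sum c S)
    moreover have nle: "norm ((\<Sum>i<N. f n i) - r n) \<le> g n * T N" for n
    proof -
      have fs: "summable (\<lambda>i. f n (i + N))" using r[of n] by (auto simp: sums_iff)
      have hs: "summable (\<lambda>i. h (i + N))" using h by simp
      have "(\<Sum>i<N. f n i) - r n = - (\<Sum>i. f n (i + N))"
        using suminf_minus_initial_segment[of "f n" N] r[of n] by (simp add: sums_iff)
      then have "norm ((\<Sum>i<N. f n i) - r n) = norm (\<Sum>i. f n (i + N))" by simp
      also have "\<dots> \<le> (\<Sum>i. g n * h (i + N))"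
        by (intro norm_suminf_le bound summable_mult hs)
      also have "\<dots> = g n * T N" unfolding T_def using hs by (rule suminf_mult)
      finally show ?thesis .
    qed
    moreover have "summable (\<lambda>n. g n * T N)" using g by (rule summable_mult2)
    moreover have "(\<Sum>n. g n * T N) = suminf g * T N" using g by (rule suminf_mult2[symmetric])
    ultimately show ?thesis
      using norm_suminf_le[of "\<lambda>n. (\<Sum>i<N. f n i) - r n" "\<lambda>n. g n * T N"] by (simp add: sums_iff)
  qed
  have "(\<lambda>N. suminf g * T N) \<longlonglongrightarrow> 0" using T0 by (rule tendsto_mult_right_zero)
  then have "(\<lambda>N. (\<Sum>i<N. c i) - S) \<longlonglongrightarrow> 0"
    by (rule Lim_null_comparison[rotated]) (simp add: le)
  then show ?thesis unfolding sums_def by (rule LIM_zero_cancel)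
qed

text \<open>
  The contributions of the integers \<open>n + 1\<close> and \<open>-(n + 1)\<close> are grouped, so that the sum over \<open>n\<close>
  converges absolutely even for \<open>i = 1\<close>.
\<close>
definition lattice_term :: "nat \<Rightarrow> nat \<Rightarrow> real" where
  "lattice_term n i = (let m = 3 * real (Suc n) in
     1 / m ^ i + 1 / (1 - m) ^ i + 1 / (- m) ^ i + 1 / (1 + m) ^ i)"

text \<open>Only \<open>i = 1\<close> needs cancellation within the group; for larger
  \<open>i\<close> all four bases have absolute value at least \<open>2 * Suc n\<close>. Uniformity
  in \<open>i\<close> makes the double series of the generating function dominated.\<close>

lemma lattice_term_bound:
  assumes "i \<ge> 1"
  shows "\<bar>lattice_term n i\<bar> \<le> 1 / real (Suc n) ^ 2"
proof (cases "i = 1")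
  case True
  define m where "m = real (Suc n)"
  have m: "m \<ge> 1" by (simp add: m_def)
  then have m2: "m ^ 2 \<ge> 1" by (simp add: one_le_power)
  have "lattice_term n i = - (2 / (9 * m ^ 2 - 1))"
  proof -
    have nz: "1 - 3 * m \<noteq> 0" "1 + 3 * m \<noteq> 0" "9 * m ^ 2 - 1 \<noteq> 0" "m \<noteq> 0" using m m2 by linarith+
    then have "1 / (1 - 3 * m) + 1 / (1 + 3 * m) = - (2 / (9 * m ^ 2 - 1))"
      by (simp add: field_simps power2_eq_square)
    then show ?thesis unfolding lattice_term_def Let_def m_def[symmetric] using True by simp
  qed
  moreover have "2 / (9 * m ^ 2 - 1) \<le> 1 / m ^ 2"
  proof -
    have "2 / (9 * m ^ 2 - 1) \<le> 2 / (2 * m ^ 2)" using m m2 by (intro frac_le) linarith+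
    then show ?thesis by simp
  qed
  ultimately show ?thesis unfolding m_def[symmetric] using m2 by simp
next
  case False
  define m where "m = real (Suc n)"
  have m: "m \<ge> 1" by (simp add: m_def)
  have one: "\<bar>1 / x ^ i\<bar> \<le> 1 / (4 * m ^ 2)" if "\<bar>x\<bar> \<ge> 2 * m" for x
  proof -
    have "(2 * m) ^ 2 \<le> \<bar>x\<bar> ^ 2" using that m by (intro power_mono) auto
    also have "\<dots> \<le> \<bar>x\<bar> ^ i" using False assms that m by (intro power_increasing) auto
    finally have "1 / \<bar>x\<bar> ^ i \<le> 1 / (2 * m) ^ 2" using m by (intro frac_le) auto
    then show ?thesis by (simp add: power_abs power_mult_distrib)
  qed
  have "\<bar>1 / (3 * m) ^ i\<bar> \<le> 1 / (4 * m ^ 2)" "\<bar>1 / (1 - 3 * m) ^ i\<bar> \<le> 1 / (4 * m ^ 2)"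
    "\<bar>1 / (- (3 * m)) ^ i\<bar> \<le> 1 / (4 * m ^ 2)" "\<bar>1 / (1 + 3 * m) ^ i\<bar> \<le> 1 / (4 * m ^ 2)"
    by (rule one; use m in simp)+
  then have "\<bar>lattice_term n i\<bar> \<le> 1 / (4 * m ^ 2) + 1 / (4 * m ^ 2) + 1 / (4 * m ^ 2) + 1 / (4 * m ^ 2)"
    unfolding lattice_term_def Let_def m_def[symmetric] by linarith
  also have "\<dots> = 1 / m ^ 2" by simp
  finally show ?thesis by (simp add: m_def)
qed

lemma summable_inverse_square_Suc: "summable (\<lambda>n. 1 / real (Suc n) ^ 2)"
  using summable_Suc_iff[of "\<lambda>n. 1 / real n ^ 2"] inverse_power_summable[of 2, where ?'a = real]
  by (simp add: inverse_eq_divide)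

definition lattice_sum :: "nat \<Rightarrow> real" where
  "lattice_sum i = (\<Sum>n. (-1) ^ Suc n * lattice_term n i)"

lemma lattice_sum_sums:
  assumes "i \<ge> 1"
  shows "(\<lambda>n. (-1) ^ Suc n * lattice_term n i) sums lattice_sum i"
  unfolding lattice_sum_def
proof (rule summable_sums, rule summable_comparison_test'[OF summable_inverse_square_Suc])
  show "norm ((-1) ^ Suc n * lattice_term n i) \<le> 1 / real (Suc n) ^ 2" for n
    using lattice_term_bound[OF assms, of n] by (simp only: real_norm_def abs_mult power_abs) simp
qed

lemma sums_geometric_over:
  fixes t a :: complex
  assumes "norm t < norm a"
  shows "(\<lambda>i. t ^ Suc i / a ^ Suc i) sums (t / (a - t))"
proof -
  have a: "a \<noteq> 0" using assms by auto
  have "a \<noteq> t" using assms by auto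
  have "norm (t / a) < 1" using assms a by (simp add: norm_divide)
  then have "(\<lambda>i. (t / a) * (t / a) ^ i) sums ((t / a) * (1 / (1 - t / a)))"
    by (intro sums_mult geometric_sums)
  moreover have "(t / a) * (1 / (1 - t / a)) = t / (a - t)"
  proof -
    have "1 - t / a = (a - t) / a" using a by (simp add: diff_divide_distrib)
    then show ?thesis using a by (simp only: times_divide_eq_right mult_1_right divide_divide_eq_left) simp
  qed
  ultimately show ?thesis by (simp only:) (simp add: power_divide)
qed

lemma not_Ints_norm_less_1:
  fixes z :: complex
  assumes "z \<noteq> 0" "norm z < 1"
  shows "z \<notin> \<int>"
proof
  assume "z \<in> \<int>"
  then obtain k where k: "z = of_int k" by (auto elim: Ints_cases)
  then have "\<bar>real_of_int k\<bar> < 1" using assms by simp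
  then have "k = 0" by linarith
  then show False using assms k by simp
qed

text \<open>Summed over the exponent first, each group of four geometric series gives the terms of
  pi / sin (pi z) at z = (1 - t) / 3 minus those at z = t / 3. The corrections 1 / z of the two
  expansions become \<open>t / (1 - t)\<close> and 1.\<close>

lemma lattice_power_series:
  fixes t :: complex
  assumes t: "t \<noteq> 0" "norm t < 1"
  defines "c \<equiv> complex_of_real pi / 3"
  shows "(\<lambda>i. of_real (lattice_sum (Suc i)) * t ^ Suc i) sums
           (1 - t / (1 - t) + c * t / sin (c * (1 - t)) - c * t / sin (c * t))"
proof -
  define M where "M = (\<lambda>n. 3 * complex_of_nat (Suc n))"
  define r where "r = (\<lambda>n. (-1) ^ Suc n * (t / (M n - t) + t / ((1 - M n) - t) + t / (- M n - t) + t / (1 + M n - t)))"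
  define f where "f = (\<lambda>n i. (-1) ^ Suc n * of_real (lattice_term n (Suc i)) * t ^ Suc i)"
  have normM: "norm (M n) \<ge> 3" for n
    unfolding M_def norm_mult norm_of_nat by simp
  have zs: "t / 3 \<notin> \<int>" "(1 - t) / 3 \<notin> \<int>"
  proof -
    show "t / 3 \<notin> \<int>" using t by (intro not_Ints_norm_less_1) (auto simp: norm_divide)
    have "norm (1 - t) \<le> 2" using norm_triangle_ineq4[of 1 t] t by simp
    then show "(1 - t) / 3 \<notin> \<int>" using t by (intro not_Ints_norm_less_1) (auto simp: norm_divide)
  qed
  have "(\<lambda>i. of_real (lattice_sum (Suc i)) * t ^ Suc i) sums
          (t / 3 * ((of_real pi / sin (of_real pi * ((1 - t) / 3)) - 1 / ((1 - t) / 3))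
                  - (of_real pi / sin (of_real pi * (t / 3)) - 1 / (t / 3))))"
  proof (rule sums_swap_dominated[where f = f and r = r and h = "\<lambda>i. norm t ^ Suc i"])
    show "norm (f n i) \<le> 1 / real (Suc n) ^ 2 * norm t ^ Suc i" for n i
      unfolding f_def norm_mult norm_power norm_of_real
      using lattice_term_bound[of "Suc i" n] by (intro mult_right_mono) auto
    show "summable (\<lambda>n. 1 / real (Suc n) ^ 2)" by (rule summable_inverse_square_Suc)
    show "summable (\<lambda>i. norm t ^ Suc i)"
      using t by (subst summable_Suc_iff[of "\<lambda>i. norm t ^ i"]) (simp add: summable_geometric)
    show "0 \<le> 1 / real (Suc n) ^ 2" for n by simp
    show "(\<lambda>n. f n i) sums (of_real (lattice_sum (Suc i)) * t ^ Suc i)" for i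
      unfolding f_def using sums_of_real[OF lattice_sum_sums[of "Suc i"], where ?'a = complex]
      by (intro sums_mult2) simp
    show "f n sums r n" for n
    proof -
      have g: "norm t < norm (M n)" "norm t < norm (1 - M n)" "norm t < norm (- M n)" "norm t < norm (1 + M n)"
        using t normM[of n] norm_triangle_ineq2[of "M n" 1] norm_triangle_ineq2[of "M n" "-1"]
        by (auto simp: norm_minus_commute add.commute)
      have "(\<lambda>i. (-1) ^ Suc n * (t ^ Suc i / M n ^ Suc i + t ^ Suc i / (1 - M n) ^ Suc i
               + t ^ Suc i / (- M n) ^ Suc i + t ^ Suc i / (1 + M n) ^ Suc i)) sums r n"
        unfolding r_def by (intro sums_mult sums_add sums_geometric_over g)
      moreover have "(-1) ^ Suc n * (t ^ Suc i / M n ^ Suc i + t ^ Suc i / (1 - M n) ^ Suc i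
               + t ^ Suc i / (- M n) ^ Suc i + t ^ Suc i / (1 + M n) ^ Suc i) = f n i" for i
      proof -
        have "complex_of_real (lattice_term n (Suc i)) = 1 / M n ^ Suc i + 1 / (1 - M n) ^ Suc i + 1 / (- M n) ^ Suc i + 1 / (1 + M n) ^ Suc i"
          unfolding lattice_term_def Let_def M_def of_real_add of_real_divide of_real_power of_real_diff of_real_minus of_real_mult of_real_of_nat_eq of_real_1 of_real_numeral ..
        then show ?thesis unfolding f_def by (simp only: distrib_right distrib_left times_divide_eq_left times_divide_eq_right mult_1_left mult_1_right mult.assoc)
      qed
      ultimately show ?thesis by simp
    qed
    have "(\<lambda>n. t / 3 * ((-1) ^ Suc n * (1 / ((1 - t) / 3 - of_nat (Suc n)) + 1 / ((1 - t) / 3 + of_nat (Suc n)))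
             - (-1) ^ Suc n * (1 / (t / 3 - of_nat (Suc n)) + 1 / (t / 3 + of_nat (Suc n))))) sums
         (t / 3 * ((of_real pi / sin (of_real pi * ((1 - t) / 3)) - 1 / ((1 - t) / 3))
                  - (of_real pi / sin (of_real pi * (t / 3)) - 1 / (t / 3))))"
      by (intro sums_mult sums_diff sin_partial_fractions zs)
    moreover have "t / 3 * ((-1) ^ Suc n * (1 / ((1 - t) / 3 - of_nat (Suc n)) + 1 / ((1 - t) / 3 + of_nat (Suc n)))
             - (-1) ^ Suc n * (1 / (t / 3 - of_nat (Suc n)) + 1 / (t / 3 + of_nat (Suc n)))) = r n" for n
    proof -
      have third: "t / 3 * (1 / (w / 3 + v)) = t / (w + 3 * v)" for w v :: complex
      proof -
        have "w / 3 + v = (w + 3 * v) / 3" by simp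
        then show ?thesis by (simp only: divide_divide_eq_right) simp
      qed
      have "t / 3 * (1 / ((1 - t) / 3 - of_nat (Suc n))) = t / ((1 - M n) - t)"
           "t / 3 * (1 / ((1 - t) / 3 + of_nat (Suc n))) = t / (1 + M n - t)"
           "t / 3 * (1 / (t / 3 - of_nat (Suc n))) = - (t / (M n - t))"
           "t / 3 * (1 / (t / 3 + of_nat (Suc n))) = - (t / (- M n - t))"
        using third[of "1 - t" "- of_nat (Suc n)"] third[of "1 - t" "of_nat (Suc n)"]
          third[of t "- of_nat (Suc n)"] third[of t "of_nat (Suc n)"]
          minus_divide_right[of t "M n - t"] minus_divide_right[of t "- M n - t"]
        by (simp_all add: M_def algebra_simps)
      then have "(-1) ^ Suc n * (t / 3 * (1 / ((1 - t) / 3 - of_nat (Suc n))) + t / 3 * (1 / ((1 - t) / 3 + of_nat (Suc n)))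
            - (t / 3 * (1 / (t / 3 - of_nat (Suc n))) + t / 3 * (1 / (t / 3 + of_nat (Suc n))))) = r n"
        unfolding r_def by (simp only:) simp
      then show ?thesis by (simp only: distrib_left right_diff_distrib mult.left_commute)
    qed
    ultimately show "r sums (t / 3 * ((of_real pi / sin (of_real pi * ((1 - t) / 3)) - 1 / ((1 - t) / 3))
                  - (of_real pi / sin (of_real pi * (t / 3)) - 1 / (t / 3))))" by simp
  qed
  moreover have "t / 3 * ((of_real pi / sin (of_real pi * ((1 - t) / 3)) - 1 / ((1 - t) / 3))
                  - (of_real pi / sin (of_real pi * (t / 3)) - 1 / (t / 3)))
      = 1 - t / (1 - t) + c * t / sin (c * (1 - t)) - c * t / sin (c * t)"
    using t by (simp add: c_def right_diff_distrib distrib_left mult_ac)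
  ultimately show ?thesis by (simp only:)
qed

section \<open>The generating function as a formal power series\<close>

lemma has_fps_expansion_unique_ev:
  fixes f g :: "complex \<Rightarrow> complex"
  assumes "f has_fps_expansion F" "g has_fps_expansion G" "eventually (\<lambda>z. f z = g z) (nhds 0)"
  shows "F = G"
proof (rule eval_fps_eqD)
  have "eventually (\<lambda>z. eval_fps F z = f z) (nhds 0)" "eventually (\<lambda>z. eval_fps G z = g z) (nhds 0)"
    using assms by (auto simp: has_fps_expansion_def)
  then show "eventually (\<lambda>z. eval_fps F z = eval_fps G z) (nhds 0)"
    using assms(3) by eventually_elim simp
qed (use assms in \<open>auto simp: has_fps_expansion_def\<close>)

text \<open>Adding 1 restores the summand \<open>(1 - 3n)\<^bsup>-i\<^esup>\<close> for \<open>n = 0\<close>.\<close>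
definition lattice_fps :: "complex fps" where
  "lattice_fps = Abs_fps (\<lambda>i. if i = 0 then 0 else of_real (lattice_sum i + 1))"

lemma lattice_fps_sums:
  fixes t :: complex
  assumes t: "t \<noteq> 0" "norm t < 1"
  defines "c \<equiv> complex_of_real pi / 3"
  shows "(\<lambda>i. fps_nth lattice_fps i * t ^ i) sums (1 + c * t / sin (c * (1 - t)) - c * t / sin (c * t))"
proof -
  have "(\<lambda>i. t ^ Suc i / 1 ^ Suc i) sums (t / (1 - t))"
    using t by (intro sums_geometric_over) auto
  from sums_add[OF lattice_power_series[OF t] this]
  have "(\<lambda>i. fps_nth lattice_fps (Suc i) * t ^ Suc i) sums (1 + c * t / sin (c * (1 - t)) - c * t / sin (c * t))"
    by (simp add: lattice_fps_def c_def algebra_simps)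
  then show ?thesis
    by (subst (asm) sums_Suc_iff) (simp add: lattice_fps_def)
qed

text \<open>Removes the shifted denominator: \<open>w\<close> divides \<open>sin (3 * u)\<close>,
  and the cubic term in \<open>sin u\<close> that remains is rewritten by the triple-angle
  formula.\<close>

lemma sin_triple_third:
  fixes u w :: complex
  assumes "w = sin (of_real pi / 3 - u)" "w \<noteq> 0"
  shows "sin (3 * u) * sin u / w - sin (3 * u) = 3 / 2 * sin u - 3 / 2 * sin (3 * u) + of_real (sqrt 3) * sin (2 * u) * sin u"
proof -
  define s where "s = sin u"
  define k where "k = cos u"
  define q where "q = complex_of_real (sqrt 3)"
  have q2: "q * q = 3" unfolding q_def of_real_mult[symmetric] by simp
  have sk: "k * k = 1 - s * s" using sin_cos_squared_add[of u] by (simp add: s_def k_def power2_eq_square algebra_simps)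
  have a: "sin (complex_of_real pi / 3) = q / 2" "cos (complex_of_real pi / 3) = 1 / 2"
  proof -
    have e: "complex_of_real pi / 3 = of_real (pi / 3)" by simp
    show "sin (complex_of_real pi / 3) = q / 2" unfolding e sin_of_real sin_60 q_def by simp
    show "cos (complex_of_real pi / 3) = 1 / 2" unfolding e cos_of_real cos_60 by simp
  qed
  have w: "w = q / 2 * k - s / 2" unfolding assms(1) sin_diff a s_def k_def by simp
  have s2: "sin (2 * u) = 2 * s * k" by (simp add: sin_double s_def k_def)
  have s3: "sin (3 * u) = 3 * s - 4 * s * s * s"
  proof -
    have "sin (3 * u) = sin (2 * u + u)" by (simp add: algebra_simps)
    also have "\<dots> = 2 * s * (k * k) + (k * k - s * s) * s"
      unfolding sin_add cos_double sin_double by (simp add: s_def k_def power2_eq_square algebra_simps)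
    finally show ?thesis unfolding sk by (simp add: algebra_simps)
  qed
  \<comment> \<open>The factor \<open>q / 2 * k + s / 2\<close> is sin (pi/3 + u).\<close>
  have f: "3 * s - 4 * s * s * s = 4 * s * w * (q / 2 * k + s / 2)"
  proof -
    have "4 * s * w * (q / 2 * k + s / 2) = s * ((q * q) * (k * k) - s * s)"
      unfolding w by (simp add: algebra_simps)
    then show ?thesis unfolding q2 sk by (simp add: algebra_simps)
  qed
  have "sin (3 * u) * sin u / w = 4 * s * (q / 2 * k + s / 2) * s"
    unfolding s3 f s_def[symmetric] using assms(2) by simp
  then show ?thesis
    unfolding s2 s3 q_def[symmetric] s_def[symmetric] by (simp add: algebra_simps)
qed

text \<open>The cosecant series are even and the last product is odd, so each parity of the exponent
  sees only one of the two parts.\<close>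

lemma lattice_fps_eq:
  defines "c \<equiv> complex_of_real pi / 3"
  shows "lattice_fps = 1 + fps_const (1/2) * cosec_fps (3 * c) - fps_const (3/2) * cosec_fps c
            + fps_const (of_real (sqrt 3) / 3) * (cosec_fps (3 * c) * fps_sin (2 * c))"
proof -
  \<comment> \<open>Both sides are compared after multiplication by \<open>sin (3ct) sin (ct)\<close>, which clears all poles.\<close>
  define G where "G = (\<lambda>t. if t = 0 then 0 else 1 + c * t / sin (c * (1 - t)) - c * t / sin (c * t))"
  define R where "R = (\<lambda>t. sin (3 * c * t) * sin (c * t) + 1/2 * (3 * c * t * sin (c * t))
     - 3/2 * (c * t * sin (3 * c * t)) + of_real (sqrt 3) / 3 * (3 * c * t * sin (2 * c * t) * sin (c * t)))"
  have nz: "c \<noteq> 0" by (simp add: c_def)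
  have ev: "eventually (\<lambda>t. norm (t :: complex) < 1) (nhds 0)"
    using eventually_nhds_in_open[of "ball 0 1" "0 :: complex"] by (simp add: dist_norm)
  \<comment> \<open>The separate value of \<open>G\<close> at 0 matters: there the formula would
    evaluate to 1 by division by zero, while its limit is 0.\<close>
  have "G has_fps_expansion lattice_fps"
  proof (rule has_fps_expansionI, use ev in eventually_elim)
    fix t :: complex assume "norm t < 1"
    then show "(\<lambda>n. fps_nth lattice_fps n * t ^ n) sums G t"
      using lattice_fps_sums[of t] by (cases "t = 0") (auto simp: G_def c_def lattice_fps_def powser_sums_zero_iff)
  qed
  then have L: "(\<lambda>t. sin (3 * c * t) * sin (c * t) * G t) has_fps_expansion (fps_sin (3 * c) * fps_sin c * lattice_fps)"
    by (intro fps_expansion_intros)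
  have R: "R has_fps_expansion (fps_sin (3 * c) * fps_sin c + fps_const (1/2) * (fps_const (3 * c) * fps_X * fps_sin c)
     - fps_const (3/2) * (fps_const c * fps_X * fps_sin (3 * c))
     + fps_const (of_real (sqrt 3) / 3) * (fps_const (3 * c) * fps_X * fps_sin (2 * c) * fps_sin c))"
    unfolding R_def by (intro fps_expansion_intros)
  have "eventually (\<lambda>t. sin (3 * c * t) * sin (c * t) * G t = R t) (nhds 0)"
    using ev
  proof eventually_elim
    fix t :: complex assume t: "norm t < 1"
    show "sin (3 * c * t) * sin (c * t) * G t = R t"
    proof (cases "t = 0")
      case True then show ?thesis by (simp add: R_def)
    next
      case False
      define u where "u = c * t"
      have "sin u \<noteq> 0"
      proof -
        have "t / 3 \<notin> \<int>" using t False by (intro not_Ints_norm_less_1) (auto simp: norm_divide)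
        then show ?thesis by (auto simp: u_def c_def sin_eq_0 mult.commute)
      qed
      moreover have "sin (of_real pi / 3 - u) \<noteq> 0"
      proof -
        have "norm (1 - t) \<le> 2" using norm_triangle_ineq4[of 1 t] t by simp
        then have "(1 - t) / 3 \<notin> \<int>" using t by (intro not_Ints_norm_less_1) (auto simp: norm_divide)
        moreover have "of_real pi / 3 - u = of_real pi * ((1 - t) / 3)" by (simp add: u_def c_def field_simps)
        ultimately show ?thesis by (auto simp: sin_eq_0 simp del: times_divide_eq_right)
      qed
      ultimately have "sin (3 * u) * sin u * (1 + u / sin (of_real pi / 3 - u) - u / sin u) =
          sin (3 * u) * sin u + u * (sin (3 * u) * sin u / sin (of_real pi / 3 - u) - sin (3 * u))"
        by (simp add: field_simps)
      also have "\<dots> = sin (3 * u) * sin u + u * (3 / 2 * sin u - 3 / 2 * sin (3 * u) + of_real (sqrt 3) * sin (2 * u) * sin u)"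
        using sin_triple_third[OF refl \<open>sin (of_real pi / 3 - u) \<noteq> 0\<close>] by simp
      also have "\<dots> = R t" by (simp add: R_def u_def algebra_simps)
      finally have "sin (3 * u) * sin u * (1 + u / sin (of_real pi / 3 - u) - u / sin u) = R t" .
      moreover have "of_real pi / 3 - u = c * (1 - t)"
        by (simp add: c_def u_def right_diff_distrib diff_divide_distrib)
      ultimately show ?thesis
        using False by (simp only: G_def u_def mult.assoc if_False)
    qed
  qed
  from L R this have "fps_sin (3 * c) * fps_sin c * lattice_fps = fps_sin (3 * c) * fps_sin c + fps_const (1/2) * (fps_const (3 * c) * fps_X * fps_sin c)
     - fps_const (3/2) * (fps_const c * fps_X * fps_sin (3 * c))
     + fps_const (of_real (sqrt 3) / 3) * (fps_const (3 * c) * fps_X * fps_sin (2 * c) * fps_sin c)"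
    by (rule has_fps_expansion_unique_ev)
  also have "\<dots> = fps_sin (3 * c) * fps_sin c * (1 + fps_const (1/2) * cosec_fps (3 * c) - fps_const (3/2) * cosec_fps c
            + fps_const (of_real (sqrt 3) / 3) * (cosec_fps (3 * c) * fps_sin (2 * c)))"
    unfolding cosec_fps_mult_sin[symmetric] by (simp only: algebra_simps mult_1_left)
  finally show ?thesis using nz by (simp add: fps_sin_eq_0_iff)
qed

subsection \<open>Values of the lattice sums\<close>

lemma ii_power_even: "(\<i> * c) ^ (2 * j) = (-1) ^ j * c ^ (2 * j)"
  unfolding power_mult_distrib by (simp add: power_mult)

text \<open>The first Bernoulli number does not vanish, but at \<open>n = 1\<close> its two
  contributions cancel.\<close>

lemma cosec_fps_nth_odd: "odd n \<Longrightarrow> fps_nth (cosec_fps c) n = 0"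
  using bernoulli_odd_eq_0[of n]
  by (cases "n = 1") (auto simp: cosec_fps_def bernoulli_fps_def numeral_fps_const elim!: oddE)

lemma cosec_fps_nth_even:
  "fps_nth (cosec_fps (of_real c)) (2 * j) =
     of_real ((-1) ^ j * c ^ (2 * j) * (2 - 2 ^ (2 * j)) * bernoulli (2 * j) / fact (2 * j))"
proof -
  have "\<i> * (2 * complex_of_real c) = \<i> * of_real (2 * c)" by simp
  then show ?thesis
    by (simp only: cosec_fps_def bernoulli_fps_def fps_sub_nth fps_mult_numeral_left fps_nth_Abs_fps ii_power_even)
       (simp add: power_mult_distrib algebra_simps diff_divide_distrib)
qed

lemma bernoulli_0: "bernoulli 0 = 1"
proof -
  have "fps_nth (bernoulli_fps 1 * (fps_exp 1 - 1)) 1 = 1"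
    by (simp add: bernoulli_fps_1)
  then have "complex_of_real (bernoulli 0) = 1" by (simp add: fps_mult_nth bernoulli_fps_def)
  then show ?thesis by simp
qed

lemma fps_sin_nth_odd:
  "fps_nth (fps_sin (complex_of_real c)) (2 * j + 1) = of_real ((-1) ^ j * c ^ (2 * j + 1) / fact (2 * j + 1))"
  by (simp add: fps_sin_def del: fact_Suc)

lemma fps_cos_nth_even:
  "fps_nth (fps_cos (complex_of_real c)) (2 * j) = of_real ((-1) ^ j * c ^ (2 * j) / fact (2 * j))"
  by (simp add: fps_cos_def)

lemma sum_even_indices:
  fixes f :: "nat \<Rightarrow> 'a :: comm_monoid_add"
  assumes "\<And>i. odd i \<Longrightarrow> f i = 0"
  shows "(\<Sum>i=0..2*j+1. f i) = (\<Sum>l=0..j. f (2 * l))"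
  by (induction j) (simp_all add: assms)

text \<open>As pi = 3c, (3c)^(2j) / 2 - (3/2) c^(2j) yields the factor 1 - 3 / 3^(2j), while 2 -
  2^(2j) = -2 (2^(2j-1) - 1).\<close>

lemma lattice_sum_even:
  assumes "j \<ge> 1"
  shows "lattice_sum (2 * j) + 1 =
    - ((-1) ^ j * pi ^ (2*j) * bernoulli (2*j) / fact (2*j) * (2 ^ (2*j-1) - 1) * (1 - 3 / 3 ^ (2*j)))"
proof -
  define c where "c = pi / 3"
  define Z where "Z = (-1) ^ j * (2 - 2 ^ (2 * j)) * bernoulli (2 * j) / fact (2 * j)"
  have K: "fps_nth (cosec_fps (of_real x)) (2 * j) = of_real (x ^ (2 * j) * Z)" for x
    unfolding cosec_fps_nth_even Z_def by (simp add: mult_ac)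
  have z: "fps_nth (cosec_fps (3 * of_real c) * fps_sin (2 * of_real c)) (2 * j) = 0"
    unfolding fps_mult_nth
  proof (rule sum.neutral, rule ballI)
    fix i assume "i \<in> {0..2 * j}"
    then show "fps_nth (cosec_fps (3 * of_real c)) i * fps_nth (fps_sin (2 * of_real c)) (2 * j - i) = 0"
      by (cases "odd i") (auto simp: cosec_fps_nth_odd fps_sin_def)
  qed
  have "complex_of_real (lattice_sum (2 * j) + 1) = fps_nth lattice_fps (2 * j)"
    using assms by (simp add: lattice_fps_def)
  also have "\<dots> = 1/2 * fps_nth (cosec_fps (of_real (3 * c))) (2 * j) - 3/2 * fps_nth (cosec_fps (of_real c)) (2 * j)"
    using assms z unfolding lattice_fps_eq by (simp add: c_def)
  also have "\<dots> = of_real (((3 * c) ^ (2 * j) / 2 - 3/2 * c ^ (2 * j)) * Z)"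
    unfolding K by (simp add: left_diff_distrib)
  finally have "lattice_sum (2 * j) + 1 = ((3 * c) ^ (2 * j) / 2 - 3/2 * c ^ (2 * j)) * Z"
    by (simp only: of_real_eq_iff)
  also have "(3 * c) ^ (2 * j) / 2 - 3/2 * c ^ (2 * j) = pi ^ (2 * j) * (1 - 3 / 3 ^ (2*j)) / 2"
    by (simp add: c_def power_divide field_simps)
  also have "Z = 2 * ((-1) ^ j * (1 - 2 ^ (2 * j - 1)) * bernoulli (2 * j) / fact (2 * j))"
    using power_Suc[of "2::real" "2 * j - 1"] assms by (simp add: Z_def right_diff_distrib left_diff_distrib diff_divide_distrib mult_ac)
  finally have "lattice_sum (2 * j) + 1 = pi ^ (2 * j) * (1 - 3 / 3 ^ (2*j)) / 2 *
      (2 * ((-1) ^ j * (1 - 2 ^ (2 * j - 1)) * bernoulli (2 * j) / fact (2 * j)))" .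
  moreover have "P * B / 2 * (2 * (s * (1 - t) * b / f)) = - (s * P * b / f * (t - 1) * B)"
    for P B s t b f :: real
    by (simp add: algebra_simps diff_divide_distrib)
  ultimately show ?thesis by (simp only:)
qed

text \<open>Only the product with the factor sqrt 3 contributes; the inner sum is the Cauchy product
  of the series of 3u cot (3u) and sin u.\<close>

lemma lattice_sum_odd:
  "lattice_sum (2 * j + 1) + 1 =
    2 / sqrt 3 * ((pi/3) ^ (2*j+1) * (-1) ^ j * ((3 * real j + 1) / fact (2*j+1)
       - 3 * (\<Sum>l=1..j. 6 ^ (2*l-1) * bernoulli (2*l) / (fact (2*j-2*l+1) * fact (2*l)))))"
proof -
  define c where "c = pi / 3"
  let ?D = "bernoulli_fps (\<i> * (6 * of_real c)) + fps_const (3 * \<i> * of_real c) * fps_X"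
  let ?T = "\<lambda>l. 6 ^ (2*l) * bernoulli (2*l) / (fact (2*j-2*l+1) * fact (2*l))"
  have D: "fps_nth ?D (2 * l) = of_real ((-1) ^ l * (6 * c) ^ (2 * l) * bernoulli (2 * l) / fact (2 * l))" for l
  proof -
    have "\<i> * (6 * complex_of_real c) = \<i> * of_real (6 * c)" by simp
    then have "fps_nth (bernoulli_fps (\<i> * (6 * of_real c))) (2 * l) = of_real ((-1) ^ l * (6 * c) ^ (2 * l) * bernoulli (2 * l) / fact (2 * l))"
      by (simp only: bernoulli_fps_def fps_nth_Abs_fps ii_power_even) simp
    moreover have "2 * l \<noteq> 1" by presburger
    ultimately show ?thesis by simp
  qed
  have "fps_nth (fps_sin (of_real c) * ?D) (2 * j + 1) = (\<Sum>i=0..2*j+1. fps_nth ?D i * fps_nth (fps_sin (of_real c)) (2 * j + 1 - i))"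
    unfolding mult.commute[of "fps_sin (of_real c)"] fps_mult_nth ..
  \<comment> \<open>The sine has odd coefficients only, so the linear term of \<open>?D\<close>
    drops out.\<close>
  also have "\<dots> = (\<Sum>l=0..j. fps_nth ?D (2 * l) * fps_nth (fps_sin (of_real c)) (2 * j + 1 - 2 * l))"
    by (rule sum_even_indices) (auto simp: fps_sin_def)
  also have "\<dots> = (\<Sum>l=0..j. of_real ((-1) ^ j * c ^ (2 * j + 1) * ?T l))"
  proof (rule sum.cong)
    fix l assume l: "l \<in> {0..j}"
    have e: "2 * j + 1 - 2 * l = 2 * (j - l) + 1" "2 * j - 2 * l + 1 = 2 * (j - l) + 1" using l by auto
    have p: "(-1::real) ^ j = (-1) ^ l * (-1) ^ (j - l)" "c ^ (2 * j + 1) = c ^ (2 * l) * c ^ (2 * (j - l) + 1)"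
      unfolding power_add[symmetric] using l by (auto intro!: arg_cong[of _ _ "power _"])
    show "fps_nth ?D (2 * l) * fps_nth (fps_sin (of_real c)) (2 * j + 1 - 2 * l) = of_real ((-1) ^ j * c ^ (2 * j + 1) * ?T l)"
      unfolding e D fps_sin_nth_odd of_real_mult[symmetric] p power_mult_distrib
      by (rule arg_cong[of _ _ of_real]) (simp only: times_divide_eq_left times_divide_eq_right divide_divide_eq_left mult_ac)
  qed simp
  also have "\<dots> = of_real ((-1) ^ j * c ^ (2 * j + 1) * (\<Sum>l=0..j. ?T l))"
    by (simp only: of_real_sum sum_distrib_left)
  finally have S: "fps_nth (fps_sin (of_real c) * ?D) (2 * j + 1) = of_real ((-1) ^ j * c ^ (2 * j + 1) * (\<Sum>l=0..j. ?T l))" .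
  have "complex_of_real (lattice_sum (2 * j + 1) + 1) = fps_nth lattice_fps (2 * j + 1)"
    by (simp add: lattice_fps_def)
  also have "\<dots> = of_real (sqrt 3) / 3 * fps_nth (cosec_fps (3 * of_real c) * fps_sin (2 * of_real c)) (2 * j + 1)"
    unfolding lattice_fps_eq by (simp add: c_def cosec_fps_nth_odd)
  also have "fps_nth (cosec_fps (3 * of_real c) * fps_sin (2 * of_real c)) (2 * j + 1) =
      3 * of_real c * fps_nth (fps_cos (of_real c)) (2 * j) - fps_nth (fps_sin (of_real c) * ?D) (2 * j + 1)"
    unfolding cosec_fps_mult_sin_double by (simp add: mult.assoc)
  also have "\<dots> = of_real (3 * c * ((-1) ^ j * c ^ (2 * j) / fact (2 * j)) - (-1) ^ j * c ^ (2 * j + 1) * (\<Sum>l=0..j. ?T l))"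
    unfolding S fps_cos_nth_even by simp
  also have "of_real (sqrt 3) / 3 * \<dots> = complex_of_real (sqrt 3 / 3 * (3 * c * ((-1) ^ j * c ^ (2 * j) / fact (2 * j)) - (-1) ^ j * c ^ (2 * j + 1) * (\<Sum>l=0..j. ?T l)))"
    by simp
  finally have "lattice_sum (2 * j + 1) + 1 = sqrt 3 / 3 * (3 * c * ((-1) ^ j * c ^ (2 * j) / fact (2 * j)) - (-1) ^ j * c ^ (2 * j + 1) * (\<Sum>l=0..j. ?T l))"
    by (simp only: of_real_eq_iff)
  also have "\<dots> = sqrt 3 / 3 * (c ^ (2 * j + 1) * (-1) ^ j * (3 / fact (2 * j) - (\<Sum>l=0..j. ?T l)))"
    by (simp add: algebra_simps)
  \<comment> \<open>The summand \<open>l = 0\<close> merges with the cosine coefficient: 3 / (2j)! -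
    1 / (2j+1)! = 2 (3j + 1) / (2j+1)!.\<close>
  also have "(\<Sum>l=0..j. ?T l) = ?T 0 + (\<Sum>l=1..j. ?T l)"
    by (simp add: sum.atLeast_Suc_atMost)
  also have "?T 0 = 1 / fact (2 * j + 1)" by (simp add: bernoulli_0)
  also have "(\<Sum>l=1..j. ?T l) = 6 * (\<Sum>l=1..j. 6 ^ (2*l-1) * bernoulli (2*l) / (fact (2*j-2*l+1) * fact (2*l)))"
    unfolding sum_distrib_left
  proof (rule sum.cong)
    fix l assume "l \<in> {1..j}"
    then have "(6::real) ^ (2 * l) = 6 * 6 ^ (2 * l - 1)" by (simp flip: power_Suc)
    then show "?T l = 6 * (6 ^ (2*l-1) * bernoulli (2*l) / (fact (2*j-2*l+1) * fact (2*l)))" by simp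
  qed simp
  also have "3 / fact (2 * j) - (1 / fact (2 * j + 1) + 6 * (\<Sum>l=1..j. 6 ^ (2*l-1) * bernoulli (2*l) / (fact (2*j-2*l+1) * fact (2*l))))
     = 2 * ((3 * real j + 1) / fact (2*j+1)
       - 3 * (\<Sum>l=1..j. 6 ^ (2*l-1) * bernoulli (2*l) / (fact (2*j-2*l+1) * fact (2*l))))"
    (is "_ - (_ + 6 * ?s) = _")
  proof -
    have f: "fact (2 * j + 1) = (2 * real j + 1) * (fact (2 * j) :: real)" by simp
    have "2 * real j + 1 \<noteq> 0" by linarith
    then have "3 / fact (2 * j) = ((2 * real j + 1) * 3) / ((2 * real j + 1) * fact (2 * j))"
      by (rule mult_divide_mult_cancel_left[symmetric])
    then have "3 / fact (2 * j) = (3 * (2 * real j + 1)) / fact (2 * j + 1)"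
      by (simp only: f mult.commute[of 3])
    then have "3 / fact (2 * j) - 1 / fact (2 * j + 1) = 2 * ((3 * real j + 1) / fact (2*j+1))"
      by (simp add: diff_divide_distrib[symmetric])
    then show ?thesis by (simp only: right_diff_distrib diff_diff_add[symmetric])
  qed
  also have "sqrt 3 / 3 = 1 / sqrt 3" by (simp add: field_simps)
  finally show ?thesis by (simp add: c_def)
qed

section \<open>Collecting the values into the closed formula\<close>

lemma sum_split_parity:
  fixes f :: "nat \<Rightarrow> 'a :: comm_monoid_add"
  assumes "k \<ge> 1"
  shows "(\<Sum>i=1..k. f i) = (\<Sum>j=1..k div 2. f (2 * j)) + (\<Sum>j=0..(k-1) div 2. f (2 * j + 1))"
proof -
  have "{1..k} = (\<lambda>j. 2 * j) ` {1..k div 2} \<union> (\<lambda>j. 2 * j + 1) ` {0..(k-1) div 2}"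
  proof (intro equalityI subsetI)
    fix i assume i: "i \<in> {1..k}"
    show "i \<in> (\<lambda>j. 2 * j) ` {1..k div 2} \<union> (\<lambda>j. 2 * j + 1) ` {0..(k-1) div 2}"
    proof (cases "even i")
      case True
      then show ?thesis using i by (intro UnI1 image_eqI[of _ _ "i div 2"]) auto
    next
      case False
      then show ?thesis using i by (intro UnI2 image_eqI[of _ _ "i div 2"]) (auto elim!: oddE)
    qed
  qed (use assms in auto)
  moreover have "(\<lambda>j. 2 * j) ` {1..k div 2} \<inter> (\<lambda>j. 2 * j + 1) ` {0..(k-1) div 2} = {}"
    by auto presburger
  ultimately show ?thesis
    by (simp add: sum.union_disjoint sum.reindex inj_on_def)
qed

text \<open>The hockey-stick identity after the substitution \<open>i = k - j\<close>.\<close>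

lemma sum_binomial_diagonal:
  assumes "k \<ge> 1"
  shows "(\<Sum>i=1..k. (2*k - i - 1) choose (k - 1)) = (2*k - 1) choose k"
proof -
  have "(\<Sum>i=1..k. (2*k - i - 1) choose (k - 1)) = (\<Sum>j\<le>k-1. (k - 1 + j) choose (k - 1))"
    by (rule sum.reindex_bij_witness[of _ "\<lambda>j. k - j" "\<lambda>i. k - i"]) (use assms in \<open>auto simp: mult_2\<close>)
  also have "\<dots> = (\<Sum>j\<le>k-1. (k - 1 + j) choose j)"
    by (intro sum.cong refl) (metis add_diff_cancel_left' binomial_symmetric le_add1)
  also have "\<dots> = Suc (k - 1 + (k - 1)) choose (k - 1)"
    by (rule sum_choose_lower)
  also have "\<dots> = (2*k - 1) choose k"
  proof -
    obtain p where "k = Suc p" using assms by (cases k) auto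
    then show ?thesis using binomial_symmetric[of p "Suc (p + p)"] by (simp add: mult_2)
  qed
  finally show ?thesis .
qed

text \<open>Passing from \<open>lattice_sum i\<close> to \<open>lattice_sum i + 1\<close> produces
  the first binomial coefficient. Even and odd \<open>i\<close> give the two sums, and
  \<open>i = 1\<close> is the isolated term with pi / sqrt 3.\<close>

lemma lattice_sum_combination:
  assumes "k \<ge> 1"
  shows "- (\<Sum>i=1..k. real ((2*k - i - 1) choose (k - 1)) * lattice_sum i) =
     real ((2*k-1) choose k)
          - 2 * pi / (3 * sqrt 3) * real ((2*k-2) choose (k-1))
          + (\<Sum>j=1..k div 2. (-1)^j * pi^(2*j) * bernoulli (2*j) / fact (2*j)
                * (2^(2*j-1) - 1) * (1 - 3 / 3^(2*j)) * real ((2*k-2*j-1) choose (k-1)))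
          - 2 / sqrt 3 * (\<Sum>j=1..(k-1) div 2. (pi/3)^(2*j+1) * (-1)^j
                * real ((2*k-2*j-2) choose (k-1))
                * ((3*real j+1) / fact (2*j+1)
                   - 3 * (\<Sum>l=1..j. 6^(2*l-1) * bernoulli (2*l)
                          / (fact (2*j-2*l+1) * fact (2*l)))))"
proof -
  let ?b = "\<lambda>i. real ((2*k - i - 1) choose (k - 1))"
  let ?g = "\<lambda>j. (3 * real j + 1) / fact (2*j+1)
       - 3 * (\<Sum>l=1..j. 6 ^ (2*l-1) * bernoulli (2*l) / (fact (2*j-2*l+1) * fact (2*l)))"
  have "- (\<Sum>i=1..k. ?b i * lattice_sum i) = (\<Sum>i=1..k. ?b i) - (\<Sum>i=1..k. ?b i * (lattice_sum i + 1))"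
    by (simp add: algebra_simps sum.distrib)
  also have "(\<Sum>i=1..k. ?b i) = real ((2*k-1) choose k)"
    using sum_binomial_diagonal[OF assms] by (simp flip: of_nat_sum)
  also have "(\<Sum>i=1..k. ?b i * (lattice_sum i + 1)) =
      (\<Sum>j=1..k div 2. ?b (2*j) * (lattice_sum (2*j) + 1)) + (\<Sum>j=0..(k-1) div 2. ?b (2*j+1) * (lattice_sum (2*j+1) + 1))"
    by (rule sum_split_parity[OF assms])
  also have "(\<Sum>j=1..k div 2. ?b (2*j) * (lattice_sum (2*j) + 1)) =
      - (\<Sum>j=1..k div 2. (-1)^j * pi^(2*j) * bernoulli (2*j) / fact (2*j)
                * (2^(2*j-1) - 1) * (1 - 3 / 3^(2*j)) * real ((2*k-2*j-1) choose (k-1)))"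
    unfolding sum_negf[symmetric]
    by (rule sum.cong) (auto simp: lattice_sum_even)
  also have "(\<Sum>j=0..(k-1) div 2. ?b (2*j+1) * (lattice_sum (2*j+1) + 1)) =
      (\<Sum>j=0..(k-1) div 2. 2 / sqrt 3 * ((pi/3)^(2*j+1) * (-1)^j * real ((2*k-2*j-2) choose (k-1)) * ?g j))"
  proof (rule sum.cong)
    fix j
    have "2*k - (2*j+1) - 1 = 2*k-2*j-2" by simp
    then show "?b (2*j+1) * (lattice_sum (2*j+1) + 1) = 2 / sqrt 3 * ((pi/3)^(2*j+1) * (-1)^j * real ((2*k-2*j-2) choose (k-1)) * ?g j)"
      unfolding lattice_sum_odd by (simp only: mult_ac)
  qed simp
  also have "\<dots> = 2 * pi / (3 * sqrt 3) * real ((2*k-2) choose (k-1)) +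
     2 / sqrt 3 * (\<Sum>j=1..(k-1) div 2. (pi/3)^(2*j+1) * (-1)^j * real ((2*k-2*j-2) choose (k-1)) * ?g j)"
    by (subst sum.atLeast_Suc_atMost) (simp_all add: sum_distrib_left)
  finally show ?thesis by simp
qed

subsection \<open>Moments of the pentagonal series\<close>

text \<open>Of the factor 6, the 2 clears the denominator of the pentagonal numbers and the 3,
  together with the sign, makes the two factors add up to 1, as
  \<open>partial_fraction_power\<close> requires.\<close>

lemma pent_eq:
  "-6 * real (pent_minus n) = 3 * real (Suc n) * (1 - 3 * real (Suc n))"
  "-6 * real (pent_plus n) = - (3 * real (Suc n)) * (1 - - (3 * real (Suc n)))"
  by (simp_all add: pent_minus_def pent_plus_def real_tri field_simps)

lemma pent_ge: "real (Suc n) ^ 2 \<le> real (pent_minus n)" "real (Suc n) ^ 2 \<le> real (pent_plus n)"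
  by (simp_all add: pent_minus_def pent_plus_def power2_eq_square algebra_simps)

lemma pent_pos: "0 < real (pent_minus n)" "0 < real (pent_plus n)"
  by (auto simp: pent_minus_def pent_plus_def intro: add_pos_nonneg simp del: of_nat_add of_nat_mult)

lemma inverse_power_pent_le:
  assumes "k \<ge> 1"
  shows "1 / real (pent_minus n) ^ k \<le> 1 / real (Suc n) ^ 2" "1 / real (pent_plus n) ^ k \<le> 1 / real (Suc n) ^ 2"
proof -
  have *: "1 / p ^ k \<le> 1 / real (Suc n) ^ 2" if "real (Suc n) ^ 2 \<le> p" for p
  proof -
    have "1 \<le> real (Suc n) ^ 2" by (rule one_le_power) simp
    then have "1 \<le> p" using that by linarith
    then have "p ^ 1 \<le> p ^ k" using assms by (intro power_increasing) auto
    then show ?thesis using that \<open>1 \<le> real (Suc n) ^ 2\<close> by (intro frac_le) auto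
  qed
  show "1 / real (pent_minus n) ^ k \<le> 1 / real (Suc n) ^ 2" "1 / real (pent_plus n) ^ k \<le> 1 / real (Suc n) ^ 2"
    by (rule *; rule pent_ge)+
qed

text \<open>The two pentagonal families are x = 3m and x = -3m in the partial fractions of 1 / (x (1
  - x))^k. The inner minus sign compensates for the sign \<open>(-1) ^ Suc n\<close> in
  \<open>lattice_sum\<close>.\<close>

lemma pentagonal_sum:
  assumes "k \<ge> 1"
  shows "(\<lambda>n. (-1) ^ n * (1 / real (pent_minus n) ^ k + 1 / real (pent_plus n) ^ k)) sums
     ((-6) ^ k * - (\<Sum>i=1..k. real ((2*k - i - 1) choose (k - 1)) * lattice_sum i))"
proof -
  let ?b = "\<lambda>i. real ((2*k - i - 1) choose (k - 1))"
  have "(-1) ^ n * (1 / real (pent_minus n) ^ k + 1 / real (pent_plus n) ^ k)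
      = (-6) ^ k * - (\<Sum>i=1..k. ?b i * ((-1) ^ Suc n * lattice_term n i))" for n
  proof -
    define m where "m = 3 * real (Suc n)"
    have m: "m \<noteq> 0" "m \<noteq> 1" "- m \<noteq> 0" "- m \<noteq> 1" by (auto simp: m_def)
    have inv: "1 / a ^ k = (-6) ^ k * (1 / (-6 * a) ^ k)" for a :: real
      unfolding power_mult_distrib by simp
    have "1 / real (pent_minus n) ^ k + 1 / real (pent_plus n) ^ k =
        (-6) ^ k * (1 / (m * (1 - m)) ^ k + 1 / (- m * (1 - - m)) ^ k)"
      unfolding inv[of "real (pent_minus n)"] inv[of "real (pent_plus n)"] pent_eq m_def by (simp only: distrib_left)
    also have "\<dots> = (-6) ^ k * (\<Sum>i=1..k. ?b i * lattice_term n i)"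
      unfolding partial_fraction_power[OF m(1,2) assms] partial_fraction_power[OF m(3,4) assms] sum.distrib[symmetric]
      unfolding lattice_term_def m_def[symmetric] Let_def by (simp add: algebra_simps)
    finally show ?thesis by (simp add: sum_distrib_left mult_ac sum_negf)
  qed
  moreover have "(\<lambda>n. (-6) ^ k * - (\<Sum>i=1..k. ?b i * ((-1) ^ Suc n * lattice_term n i))) sums
      ((-6) ^ k * - (\<Sum>i=1..k. ?b i * lattice_sum i))"
    by (intro sums_mult sums_minus sums_sum lattice_sum_sums) auto
  ultimately show ?thesis by simp
qed

text \<open>The integrand is \<open>fact k / a ^ k\<close> times an Erlang density, which has mass
  1.\<close>

lemma has_bochner_integral_power_exp:
  assumes "a > 0" "k \<ge> 1"
  shows "has_bochner_integral lborel (\<lambda>x. indicator {0..} x * (real k * x ^ (k - 1) * exp (- (a * x)))) (fact k / a ^ k)"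
proof -
  obtain p where k: "k = Suc p" using assms by (cases k) auto
  have "has_bochner_integral lborel (erlang_density p a) 1"
    using nn_integral_erlang_ith_moment[OF assms(1), of p 0] assms(1)
    by (intro has_bochner_integral_nn_integral) auto
  then have "has_bochner_integral lborel (\<lambda>x. fact k / a ^ k * erlang_density p a x) (fact k / a ^ k * 1)"
    by (rule has_bochner_integral_mult_right)
  also have "(\<lambda>x. fact k / a ^ k * erlang_density p a x) = (\<lambda>x. indicator {0..} x * (real k * x ^ (k - 1) * exp (- (a * x))))"
    using assms(1) by (auto simp: fun_eq_iff erlang_density_def k indicator_def)
  finally show ?thesis by simp
qed

text \<open>Termwise integration is justified by the L1 norms of the terms: they are
  \<open>fact k\<close> times sums of inverse powers of pentagonal numbers, which grow
  quadratically.\<close>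

lemma has_bochner_integral_euler_tail:
  assumes k: "k \<ge> 1"
  shows "has_bochner_integral lborel
    (\<lambda>x. indicator {0<..} x * (real k * x ^ (k - 1)) * (1 - lim (euler_partial (exp (- x)))))
    (fact k * (-6) ^ k * - (\<Sum>i=1..k. real ((2*k - i - 1) choose (k - 1)) * lattice_sum i))"
    (is "has_bochner_integral _ ?F (fact k * (-6) ^ k * - ?S)")
proof -
  define h where "h = (\<lambda>a x. indicator {0..} x * (real k * x ^ (k - 1) * exp (- (a * x))))"
  define f where "f = (\<lambda>n x. (-1) ^ n * (h (real (pent_minus n)) x + h (real (pent_plus n)) x))"
  have h: "has_bochner_integral lborel (h a) (fact k / a ^ k)" if "a > 0" for a
    unfolding h_def using has_bochner_integral_power_exp[OF that k] .
  have h0: "0 \<le> h a x" for a x by (simp add: h_def indicator_def)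
  have hh: "has_bochner_integral lborel (\<lambda>x. h (real (pent_minus n)) x + h (real (pent_plus n)) x)
      (fact k / real (pent_minus n) ^ k + fact k / real (pent_plus n) ^ k)" for n
    by (intro has_bochner_integral_add h pent_pos)
  have f: "has_bochner_integral lborel (f n) ((-1) ^ n * (fact k / real (pent_minus n) ^ k + fact k / real (pent_plus n) ^ k))" for n
    unfolding f_def by (intro has_bochner_integral_mult_right hh)
  have nf: "norm (f n x) = h (real (pent_minus n)) x + h (real (pent_plus n)) x" for n x
    by (simp add: f_def abs_mult h0)
  have fs: "f n x = indicator {0..} x * (real k * x ^ (k - 1)) *
     ((-1)^n * (exp (- x) ^ pent_minus n + exp (- x) ^ pent_plus n))" for n x
    by (simp add: f_def h_def exp_of_nat_mult[symmetric] algebra_simps)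
  have sums: "(\<lambda>n. f n x) sums ?F x" if "x > 0" for x
    using sums_mult[OF pentagonal_number[of "exp (- x)"], of "real k * x ^ (k - 1)"] that unfolding fs
    by simp
  \<comment> \<open>At \<open>x = 0\<close> one has q = 1, and for \<open>k = 1\<close> the terms do
    not tend to 0 there.\<close>
  have AE0: "AE x in lborel. x \<noteq> (0::real)" by (rule AE_lborel_singleton)
  have int: "integrable lborel (f n)" for n using f by (auto simp: has_bochner_integral_iff)
  have sumn: "AE x in lborel. summable (\<lambda>n. norm (f n x))"
    using AE0
  proof eventually_elim
    fix x :: real assume "x \<noteq> 0"
    show "summable (\<lambda>n. norm (f n x))"
    proof (cases "x > 0")
      case True
      define q where "q = exp (- x)"
      have q: "0 \<le> q" "q < 1" using True by (auto simp: q_def)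
      show ?thesis
      proof (rule summable_comparison_test')
        show "summable (\<lambda>n. real k * x ^ (k - 1) * (2 * q ^ n))"
          using q by (intro summable_mult summable_geometric) auto
        fix n
        have "q ^ pent_minus n \<le> q ^ n" "q ^ pent_plus n \<le> q ^ n"
          using q pentagonal_exponent_le[of n] by (auto intro!: power_decreasing)
        then have "q ^ pent_minus n + q ^ pent_plus n \<le> 2 * q ^ n" by linarith
        then show "norm (norm (f n x)) \<le> real k * x ^ (k - 1) * (2 * q ^ n)"
          unfolding fs q_def[symmetric] using True q
          by (simp add: abs_mult mult_left_mono)
      qed
    next
      case False
      then have "f n x = 0" for n using \<open>x \<noteq> 0\<close> by (simp add: fs)
      then show ?thesis by simp
    qed
  qed
  have sumi: "summable (\<lambda>n. \<integral>x. norm (f n x) \<partial>lborel)"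
  proof -
    have "(\<integral>x. norm (f n x) \<partial>lborel) = fact k * (1 / real (pent_minus n) ^ k + 1 / real (pent_plus n) ^ k)" for n
      unfolding nf using has_bochner_integral_integral_eq[OF hh[of n]] by (simp add: distrib_left)
    moreover have "summable (\<lambda>n. fact k * (1 / real (pent_minus n) ^ k + 1 / real (pent_plus n) ^ k))"
      by (intro summable_mult summable_add summable_comparison_test'[OF summable_inverse_square_Suc])
         (use inverse_power_pent_le[OF k] in auto)
    ultimately show ?thesis by simp
  qed
  have "(\<lambda>n. \<integral>x. f n x \<partial>lborel) sums (\<integral>x. (\<Sum>n. f n x) \<partial>lborel)"
    by (rule sums_integral[OF int sumn sumi])
  moreover have "(\<lambda>n. \<integral>x. f n x \<partial>lborel) sums (fact k * ((-6) ^ k * - ?S))"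
    using sums_mult[OF pentagonal_sum[OF k], of "fact k"] has_bochner_integral_integral_eq[OF f]
    by (simp add: algebra_simps)
  ultimately have "(\<integral>x. (\<Sum>n. f n x) \<partial>lborel) = fact k * (-6) ^ k * - ?S"
    using sums_unique2 by (simp only: mult.assoc) blast
  then have hb: "has_bochner_integral lborel (\<lambda>x. \<Sum>n. f n x) (fact k * (-6) ^ k * - ?S)"
    using integrable_suminf[OF int sumn sumi] by (simp add: has_bochner_integral_iff)
  have ae: "AE x in lborel. (\<Sum>n. f n x) = ?F x"
    using AE0
  proof eventually_elim
    fix x :: real assume "x \<noteq> 0"
    show "(\<Sum>n. f n x) = ?F x"
    proof (cases "x > 0")
      case True
      then show ?thesis using sums by (simp add: sums_iff)
    next
      case False
      then have "f n x = 0" for n using \<open>x \<noteq> 0\<close> by (simp add: fs)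
      then show ?thesis using False by simp
    qed
  qed
  have meas: "?F \<in> borel_measurable lborel"
    unfolding euler_partial_def by measurable
  have "(\<lambda>x. \<Sum>n. f n x) \<in> borel_measurable lborel"
    using hb by (auto simp: has_bochner_integral_iff)
  from has_bochner_integral_cong_AE[OF this meas ae] hb show ?thesis by blast
qed

subsection \<open>The distribution of the maximum\<close>

text \<open>
  The supremum has a junk value on the null set where the sequence is unbounded; as this value is
  constant, the supremum is measurable even if the measure is not complete.
\<close>
lemma Sup_real_unbounded:
  fixes S :: "real set"
  assumes "\<not> bdd_above S"
  shows "Sup S = (LEAST z. False)"
  using assms unfolding Sup_real_def bdd_above_def by metis

lemma borel_measurable_SUP_real:
  fixes Y :: "nat \<Rightarrow> 'a \<Rightarrow> real"
  assumes [measurable]: "\<And>i. Y i \<in> borel_measurable M"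
  shows "(\<lambda>\<omega>. SUP i. Y i \<omega>) \<in> borel_measurable M"
proof -
  \<comment> \<open>Natural bounds suffice and keep the union countable; on the complement of
    \<open>B\<close> the functions are replaced by 0, so that the suprema below are bounded
    everywhere.\<close>
  define B where "B = {\<omega> \<in> space M. \<exists>n::nat. \<forall>i. Y i \<omega> \<le> real n}"
  have [measurable]: "B \<in> sets M" unfolding B_def by measurable
  have bdd: "bdd_above (range (\<lambda>i. Y i \<omega>)) \<longleftrightarrow> \<omega> \<in> B" if "\<omega> \<in> space M" for \<omega>
  proof
    assume "bdd_above (range (\<lambda>i. Y i \<omega>))"
    then obtain m where "\<forall>i. Y i \<omega> \<le> m" by (auto simp: bdd_above_def)
    moreover obtain n :: nat where "m \<le> real n" using real_arch_simple by blast
    ultimately have "\<forall>i. Y i \<omega> \<le> real n" by (meson order_trans)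
    then show "\<omega> \<in> B" using that by (auto simp: B_def)
  qed (auto simp: B_def bdd_above_def)
  define Y' where "Y' = (\<lambda>i \<omega>. if \<omega> \<in> B then Y i \<omega> else 0)"
  have "(\<lambda>\<omega>. SUP i. Y' i \<omega>) \<in> borel_measurable M"
  proof (rule borel_measurable_cSUP)
    show "Y' i \<in> borel_measurable M" for i unfolding Y'_def by measurable
    show "bdd_above (range (\<lambda>i. Y' i \<omega>))" if "\<omega> \<in> space M" for \<omega>
      using bdd[OF that] by (cases "\<omega> \<in> B") (auto simp: Y'_def)
  qed simp
  then have "(\<lambda>\<omega>. if \<omega> \<in> B then SUP i. Y' i \<omega> else (LEAST z. False)) \<in> borel_measurable M"
    by measurable
  then show ?thesis
  proof (rule measurable_cong[THEN iffD1, rotated])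
    fix \<omega> assume "\<omega> \<in> space M"
    then show "(if \<omega> \<in> B then SUP i. Y' i \<omega> else (LEAST z. False)) = (SUP i. Y i \<omega>)"
      using bdd[of \<omega>] Sup_real_unbounded[of "range (\<lambda>i. Y i \<omega>)"] by (auto simp: Y'_def)
  qed
qed

text \<open>Layer-cake formula: z^k is the integral of k x^(k-1) over [0, z], and Tonelli exchanges
  the integrals without prior knowledge of integrability.\<close>

lemma (in prob_space) nn_integral_power_tail:
  fixes Z :: "'a \<Rightarrow> real"
  assumes [measurable]: "Z \<in> borel_measurable M" and pos: "AE \<omega> in M. 0 \<le> Z \<omega>" and k: "k \<ge> 1"
  shows "(\<integral>\<^sup>+\<omega>. ennreal (Z \<omega> ^ k) \<partial>M) =
    (\<integral>\<^sup>+x. ennreal (indicator {0<..} x * (real k * x ^ (k - 1)) * prob {\<omega> \<in> space M. x < Z \<omega>}) \<partial>lborel)"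
proof -
  interpret pair_sigma_finite M "lborel :: real measure" ..
  define w where "w = (\<lambda>x::real. indicator {0<..} x * (real k * x ^ (k - 1)))"
  have [measurable]: "w \<in> borel_measurable borel" unfolding w_def by measurable
  have w0: "0 \<le> w x" for x by (simp add: w_def indicator_def)
  have inner: "(\<integral>\<^sup>+x. ennreal (w x) * indicator {x. x < z} x \<partial>lborel) = ennreal (z ^ k)" if "0 \<le> z" for z
  proof -
    have "(\<integral>\<^sup>+x. ennreal (w x) * indicator {x. x < z} x \<partial>lborel) =
        (\<integral>\<^sup>+x. ennreal (real k * x ^ (k - 1)) * indicator {0..z} x \<partial>lborel)"
    proof (rule nn_integral_cong_AE)
      have "AE x in lborel. x \<noteq> (0::real)" "AE x in lborel. x \<noteq> z" by (rule AE_lborel_singleton)+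
      then show "AE x in lborel. ennreal (w x) * indicator {x. x < z} x = ennreal (real k * x ^ (k - 1)) * indicator {0..z} x"
        by eventually_elim (auto simp: w_def indicator_def)
    qed
    also have "\<dots> = ennreal (z ^ k - 0 ^ k)"
      using that by (intro nn_integral_FTC_Icc) (auto intro!: derivative_eq_intros)
    finally show ?thesis using k by (simp add: power_0_left)
  qed
  have "(\<integral>\<^sup>+\<omega>. ennreal (Z \<omega> ^ k) \<partial>M) = (\<integral>\<^sup>+\<omega>. (\<integral>\<^sup>+x. ennreal (w x) * indicator {x. x < Z \<omega>} x \<partial>lborel) \<partial>M)"
    using pos by (intro nn_integral_cong_AE) (auto simp: inner)
  also have "\<dots> = (\<integral>\<^sup>+\<omega>. (\<integral>\<^sup>+x. ennreal (w x) * indicator {\<omega> \<in> space M. x < Z \<omega>} \<omega> \<partial>lborel) \<partial>M)"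
    by (intro nn_integral_cong) (auto simp: indicator_def)
  also have "\<dots> = (\<integral>\<^sup>+x. (\<integral>\<^sup>+\<omega>. ennreal (w x) * indicator {\<omega> \<in> space M. x < Z \<omega>} \<omega> \<partial>M) \<partial>lborel)"
    by (intro Fubini'[symmetric]) measurable
  also have "\<dots> = (\<integral>\<^sup>+x. ennreal (w x * prob {\<omega> \<in> space M. x < Z \<omega>}) \<partial>lborel)"
    by (intro nn_integral_cong) (simp add: nn_integral_cmult emeasure_eq_measure ennreal_mult w0)
  finally show ?thesis unfolding w_def .
qed

section \<open>The law of the supremum of independent exponential variables\<close>

context prob_space
begin

context
  fixes X :: "nat \<Rightarrow> 'a \<Rightarrow> real"
  assumes indep: "indep_vars (\<lambda>_. borel) X {1..}"
    and distr: "\<And>i. i \<ge> 1 \<Longrightarrow> distributed M lborel (X i) (exponential_density (real i))"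
begin

lemma exp_var_measurable: "i \<ge> 1 \<Longrightarrow> X i \<in> borel_measurable M"
  using distributed_measurable[OF distr[of i]] by simp

lemma prob_all_exp_le:
  assumes "x > 0"
  shows "euler_partial (exp (- x)) \<longlonglongrightarrow> prob {\<omega> \<in> space M. \<forall>i. X (Suc i) \<omega> \<le> x}"
proof -
  have [measurable]: "X (Suc i) \<in> borel_measurable M" for i by (rule exp_var_measurable) simp
  define A where "A = (\<lambda>n. {\<omega> \<in> space M. \<forall>i<n. X (Suc i) \<omega> \<le> x})"
  have "prob (A n) = euler_partial (exp (- x)) n" for n
  \<comment> \<open>The intersection over an empty index set would be the whole type instead of the
    sample space.\<close>
  proof (cases "n = 0")
    case True
    then show ?thesis by (simp add: A_def euler_partial_def prob_space)
  next
    case False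
    have "A n = (\<Inter>i\<in>{1..n}. X i -` {..x} \<inter> space M)"
    proof -
      have "(\<forall>i<n. X (Suc i) \<omega> \<le> x) \<longleftrightarrow> (\<forall>i\<in>{1..n}. X i \<omega> \<le> x)" for \<omega>
        by (auto simp: Suc_le_eq) (metis Suc_le_eq Suc_pred' less_Suc_eq_le not_less_eq)
      then show ?thesis using False by (auto simp: A_def)
    qed
    also have "prob \<dots> = (\<Prod>i\<in>{1..n}. prob (X i -` {..x} \<inter> space M))"
      using False by (intro indep_varsD[OF indep]) auto
    also have "\<dots> = euler_partial (exp (- x)) n"
      unfolding euler_partial_def
    proof (rule prod.cong)
      fix i assume "i \<in> {1..n}"
      then have "\<P>(\<omega> in M. X i \<omega> \<le> x) = 1 - exp (- x * real i)"
        using assms by (intro exponential_distributedD_le distr) auto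
      moreover have "{\<omega> \<in> space M. X i \<omega> \<le> x} = X i -` {..x} \<inter> space M" by auto
      ultimately show "prob (X i -` {..x} \<inter> space M) = 1 - exp (- x) ^ i"
        by (simp add: exp_of_nat_mult[symmetric] mult.commute)
    qed simp
    finally show ?thesis .
  qed
  moreover have "(\<lambda>n. prob (A n)) \<longlonglongrightarrow> prob (\<Inter>n. A n)"
    by (rule finite_Lim_measure_decseq) (auto simp: A_def decseq_def)
  moreover have "(\<Inter>n. A n) = {\<omega> \<in> space M. \<forall>i. X (Suc i) \<omega> \<le> x}"
    by (auto simp: A_def)
  ultimately show ?thesis by simp
qed

text \<open>Borel-Cantelli at threshold 1: the tail probabilities \<open>exp (-1) ^ Suc i\<close>
  are geometric, so almost surely only finitely many variables exceed 1.\<close>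

lemma AE_exp_bdd_above: "AE \<omega> in M. bdd_above (range (\<lambda>i. X (Suc i) \<omega>))"
proof -
  have [measurable]: "X (Suc i) \<in> borel_measurable M" for i by (rule exp_var_measurable) simp
  define A where "A = (\<lambda>i. {\<omega> \<in> space M. 1 < X (Suc i) \<omega>})"
  have "AE \<omega> in M. eventually (\<lambda>i. \<omega> \<in> space M - A i) sequentially"
  proof (rule borel_cantelli_AE1)
    show "A i \<in> sets M" for i unfolding A_def by measurable
    show "emeasure M (A i) < \<infinity>" for i by (simp add: emeasure_eq_measure)
    have "prob (A i) = exp (-1) ^ Suc i" for i
      unfolding A_def using exponential_distributedD_gt[OF distr[of "Suc i"], of 1]
      by (simp add: exp_of_nat_mult[symmetric] exp_add[symmetric] algebra_simps)
    then show "summable (\<lambda>i. prob (A i))"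
      using summable_Suc_iff[of "\<lambda>i. exp (-1::real) ^ i"] by (simp add: summable_geometric)
  qed
  then show ?thesis
  proof eventually_elim
    fix \<omega> assume "eventually (\<lambda>i. \<omega> \<in> space M - A i) sequentially"
    then obtain N where N: "\<And>i. i \<ge> N \<Longrightarrow> X (Suc i) \<omega> \<le> 1"
      by (auto simp: eventually_sequentially A_def not_less)
    have "range (\<lambda>i. X (Suc i) \<omega>) \<subseteq> (\<lambda>i. X (Suc i) \<omega>) ` {..<N} \<union> {..1}"
      using N by (auto simp: image_iff) (metis lessThan_iff not_less)
    then show "bdd_above (range (\<lambda>i. X (Suc i) \<omega>))"
      by (rule bdd_above_mono[rotated]) auto
  qed
qed

text \<open>The supremum dominates the almost surely positive \<open>X 1\<close>, but only where the
  sequence is bounded.\<close>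

lemma AE_exp_SUP_nonneg: "AE \<omega> in M. 0 \<le> (SUP i. X (Suc i) \<omega>)"
proof -
  have [measurable]: "X (Suc i) \<in> borel_measurable M" for i by (rule exp_var_measurable) simp
  have "\<P>(\<omega> in M. 0 < X 1 \<omega>) = 1"
    using exponential_distributedD_gt[OF distr[of 1], of 0] by simp
  then have "AE \<omega> in M. 0 < X 1 \<omega>" by (subst (asm) prob_Collect_eq_1) auto
  with AE_exp_bdd_above show ?thesis
  proof eventually_elim
    fix \<omega> assume b: "bdd_above (range (\<lambda>i. X (Suc i) \<omega>))" and p: "0 < X 1 \<omega>"
    show "0 \<le> (SUP i. X (Suc i) \<omega>)"
      using cSUP_upper[OF _ b, of 0] p by simp
  qed
qed

text \<open>The event and the complement of "all at most \<open>x\<close>" agree only where the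
  supremum is not a junk value, hence the comparison almost everywhere.\<close>

lemma prob_exp_SUP_gt:
  assumes "x > 0"
  shows "prob {\<omega> \<in> space M. x < (SUP i. X (Suc i) \<omega>)} = 1 - lim (euler_partial (exp (- x)))"
proof -
  have [measurable]: "X (Suc i) \<in> borel_measurable M" for i by (rule exp_var_measurable) simp
  have [measurable]: "(\<lambda>\<omega>. SUP i. X (Suc i) \<omega>) \<in> borel_measurable M"
    by (rule borel_measurable_SUP_real) simp
  have "prob {\<omega> \<in> space M. x < (SUP i. X (Suc i) \<omega>)} = prob (space M - {\<omega> \<in> space M. \<forall>i. X (Suc i) \<omega> \<le> x})"
  proof (rule finite_measure_eq_AE)
    show "AE \<omega> in M. (\<omega> \<in> {\<omega> \<in> space M. x < (SUP i. X (Suc i) \<omega>)}) = (\<omega> \<in> space M - {\<omega> \<in> space M. \<forall>i. X (Suc i) \<omega> \<le> x})"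
      using AE_exp_bdd_above
    proof eventually_elim
      fix \<omega> assume b: "bdd_above (range (\<lambda>i. X (Suc i) \<omega>))"
      have "x < (SUP i. X (Suc i) \<omega>) \<longleftrightarrow> (\<exists>i. x < X (Suc i) \<omega>)"
        by (subst less_cSUP_iff[OF _ b]) auto
      then show "(\<omega> \<in> {\<omega> \<in> space M. x < (SUP i. X (Suc i) \<omega>)}) = (\<omega> \<in> space M - {\<omega> \<in> space M. \<forall>i. X (Suc i) \<omega> \<le> x})"
        by (auto simp: not_le)
    qed
  qed measurable
  also have "\<dots> = 1 - prob {\<omega> \<in> space M. \<forall>i. X (Suc i) \<omega> \<le> x}"
    by (rule prob_compl) measurable
  also have "prob {\<omega> \<in> space M. \<forall>i. X (Suc i) \<omega> \<le> x} = lim (euler_partial (exp (- x)))"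
    using limI[OF prob_all_exp_le[OF assms]] by simp
  finally show ?thesis .
qed

end
end

theorem theorem4:
  fixes P :: "'a measure" and X :: "nat \<Rightarrow> 'a \<Rightarrow> real" and k :: nat
  assumes "prob_space P"
    and "prob_space.indep_vars P (\<lambda>_. borel) X {1..}"
    and "\<And>i. i \<ge> 1 \<Longrightarrow> distributed P lborel (X i) (exponential_density (real i))"
    and "k \<ge> 1"
  shows "integrable P (\<lambda>\<omega>. (SUP i\<in>{1..}. X i \<omega>) ^ k)
    \<and> prob_space.expectation P (\<lambda>\<omega>. (SUP i\<in>{1..}. X i \<omega>) ^ k) =
      fact k * (-6) ^ k *
        ( real ((2*k-1) choose k)
          - 2 * pi / (3 * sqrt 3) * real ((2*k-2) choose (k-1))
          + (\<Sum>j=1..k div 2. (-1)^j * pi^(2*j) * bernoulli (2*j) / fact (2*j)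
                * (2^(2*j-1) - 1) * (1 - 3 / 3^(2*j)) * real ((2*k-2*j-1) choose (k-1)))
          - 2 / sqrt 3 * (\<Sum>j=1..(k-1) div 2. (pi/3)^(2*j+1) * (-1)^j
                * real ((2*k-2*j-2) choose (k-1))
                * ((3*real j+1) / fact (2*j+1)
                   - 3 * (\<Sum>l=1..j. 6^(2*l-1) * bernoulli (2*l)
                          / (fact (2*j-2*l+1) * fact (2*l))))))"
proof -
  interpret prob_space P by fact
  note iid = assms(2,3)
  define Z where "Z = (\<lambda>\<omega>. SUP i. X (Suc i) \<omega>)"
  have SUP_eq: "(SUP i\<in>{1..}. X i \<omega>) = Z \<omega>" for \<omega>
  proof -
    have "{1..} = range Suc" by (auto simp: image_iff Suc_le_eq) (metis Suc_pred')
    then show ?thesis by (simp add: Z_def image_image)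
  qed
  have [measurable]: "Z \<in> borel_measurable P"
    unfolding Z_def by (intro borel_measurable_SUP_real exp_var_measurable[OF iid]) auto
  have pos: "AE \<omega> in P. 0 \<le> Z \<omega>"
    unfolding Z_def by (rule AE_exp_SUP_nonneg[OF iid])
  define v where "v = fact k * (-6) ^ k * - (\<Sum>i=1..k. real ((2*k - i - 1) choose (k - 1)) * lattice_sum i)"
  define F where "F = (\<lambda>x. indicator {0<..} x * (real k * x ^ (k - 1)) * prob {\<omega> \<in> space P. x < Z \<omega>})"
  have "F = (\<lambda>x. indicator {0<..} x * (real k * x ^ (k - 1)) * (1 - lim (euler_partial (exp (- x)))))"
    unfolding F_def Z_def using prob_exp_SUP_gt[OF iid] by (auto simp: fun_eq_iff indicator_def)
  then have F: "has_bochner_integral lborel F v"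
    unfolding v_def using has_bochner_integral_euler_tail[OF \<open>k \<ge> 1\<close>] by simp
  have F0: "0 \<le> F x" for x by (simp add: F_def indicator_def)
  \<comment> \<open>\<open>ennreal v\<close> truncates negative numbers, so the sign of
    \<open>v\<close> is needed to recover it; it is read off from the integral of the nonnegative
    \<open>F\<close>.\<close>
  have v0: "0 \<le> v"
    using has_bochner_integral_integral_eq[OF F] Bochner_Integration.integral_nonneg[of lborel F] F0 by simp
  have "(\<integral>\<^sup>+\<omega>. ennreal (Z \<omega> ^ k) \<partial>P) = (\<integral>\<^sup>+x. ennreal (F x) \<partial>lborel)"
    unfolding F_def using pos \<open>k \<ge> 1\<close> by (intro nn_integral_power_tail) auto
  also have "\<dots> = ennreal v"
    using F F0 by (simp add: has_bochner_integral_iff nn_integral_eq_integral)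
  finally have "has_bochner_integral P (\<lambda>\<omega>. Z \<omega> ^ k) v"
    using v0 pos by (intro has_bochner_integral_nn_integral) auto
  then show ?thesis
    unfolding SUP_eq lattice_sum_combination[OF \<open>k \<ge> 1\<close>, symmetric] v_def[symmetric]
    by (simp add: has_bochner_integral_iff)
qed

end
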